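(* Let $\beta$ be a non-degenerate bilinear form on $\mathbb C^n$ that is either symmetric or skew-symmetric, and let $K\subset\mathrm{GL}_n(\mathbb C)$ be the subgroup of matrices preserving $\beta$, so that $K=\mathrm O(n)$ when $\beta$ is symmetric and $K=\mathrm{Sp}(n)$ (with $n$ even) when $\beta$ is skew-symmetric. Let $y\in\mathcal I_K$. Then the $K$-orbit closure $Y^K_y$ satisfies $$Y^K_y=\left\{F_\bullet\in\mathrm{Fl}(n): \operatorname{rank}\left(\beta|_{F_i\times F_j}\right)\le \operatorname{rk}_y(i,j)\text{ for each }(i,j)\in\operatorname{Ess}(D)\right\},$$ where $D=\hat D(y)$ when $K=\mathrm O(n)$ and $D=\hat D_{\mathrm{FPF}}(y)$ when $K=\mathrm{Sp}(n)$.
   Context: $\mathrm{Fl}(n)$ is the projective variety of complete flags $F_\bullet=(0=F_0\subsetneq F_1\subsetneq\dots\subsetneq F_n=\mathbb C^n)$ with $\dim F_i=i$. $\mathcal I_{\mathrm O(n)}$ is the set of all $y\in S_n$ with $y=y^{-1}$, and $\mathcal I_{\mathrm{Sp}(n)}$ ($n$ even) is the set of fixed-point-free involutions in $S_n$. Write $[n]=\{1,\dots,n\}$ and $\mathbb P=\{1,2,3,\dots\}$. For $y\in S_n$ and $i,j\in[n]$, $\operatorname{rk}_y(i,j)=|\{t\in[i]:y(t)\in[j]\}|$. For subspaces $F_i,F_j$, $\beta|_{F_i\times F_j}$ denotes the linear map $F_i\to F_j^*$, $v\mapsto\beta(v,\cdot)$. For $y\in\mathcal I_K$, the $K$-orbit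 associated to $y$ is $$\mathring Y^K_y=\{F_\bullet\in\mathrm{Fl}(n):\operatorname{rank}(\beta|_{F_i\times F_j})=\operatorname{rk}_y(i,j)\text{ for each }i,j\in[n]\},$$ and $Y^K_y$ is the Zariski closure of $\mathring Y^K_y$ in $\mathrm{Fl}(n)$. (It is known that $Y^K_y=\{F_\bullet\in\mathrm{Fl}(n):\operatorname{rank}(\beta|_{F_i\times F_j})\le\operatorname{rk}_y(i,j)\text{ for all }i,j\in[n]\}$.) The involution Rothe diagrams of an involution $y$ are $$\hat D(y)=\{(i,j)\in\mathbb P\times\mathbb P: j<y(i),\ i<y(j),\ j\le i\},\qquad \hat D_{\mathrm{FPF}}(y)=\{(i,j)\in\mathbb P\times\mathbb P: j<y(i),\ i<y(j),\ j<i\},$$ where $y$ fixes all integers greater than $n$. For $D\subset\mathbb P\times\mathbb P$, $$\operatorname{Ess}(D)=\{(i,j)\in D:(i+1,j),(i,j+1),(i+1,j+1)\notin D\}.$$ *)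

theory Defs
  imports
    "HOL-Analysis.Analysis"
    "HOL-Combinatorics.Permutations"
    "HOL-Library.FuncSet"
    "HOL-Library.Function_Algebras"
begin

text \<open>Throughout, \<open>n = CARD('n)\<close> and \<open>complex ^ 'n\<close> is the space of column vectors of length \<open>n\<close>.
  The ordering of the coordinates plays no role, since the bilinear form is arbitrary.\<close>

section \<open>Bilinear forms and ranks\<close>

interpretation fun_space: vector_space "\<lambda>(c::complex) (f::'a \<Rightarrow> complex) x. c * f x"
  by unfold_locales (auto simp: fun_eq_iff algebra_simps)

definition bilinear_form :: "(complex ^ 'n \<Rightarrow> complex ^ 'n \<Rightarrow> complex) \<Rightarrow> bool" where
  "bilinear_form \<beta> \<longleftrightarrow>
     (\<forall>v. Vector_Spaces.linear (*s) (*) (\<lambda>w. \<beta> v w)) \<and>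
     (\<forall>w. Vector_Spaces.linear (*s) (*) (\<lambda>v. \<beta> v w))"

definition symmetric_form :: "(complex ^ 'n \<Rightarrow> complex ^ 'n \<Rightarrow> complex) \<Rightarrow> bool" where
  "symmetric_form \<beta> \<longleftrightarrow> (\<forall>v w. \<beta> v w = \<beta> w v)"

definition skew_form :: "(complex ^ 'n \<Rightarrow> complex ^ 'n \<Rightarrow> complex) \<Rightarrow> bool" where
  "skew_form \<beta> \<longleftrightarrow> (\<forall>v w. \<beta> v w = - \<beta> w v)"

text \<open>For symmetric and skew-symmetric forms the left and right radicals coincide.\<close>

definition nondegenerate :: "(complex ^ 'n \<Rightarrow> complex ^ 'n \<Rightarrow> complex) \<Rightarrow> bool" where
  "nondegenerate \<beta> \<longleftrightarrow> (\<forall>v. (\<forall>w. \<beta> v w = 0) \<longrightarrow> v = 0)"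

text \<open>The linear functional \<open>\<beta>(v, -)\<close> on the subspace \<open>W\<close>. Elements of the dual of \<open>W\<close> are represented
  by functions extended by zero outside \<open>W\<close>, so that they form a linear subspace of the space
  of all functions.\<close>

definition restricted_functional ::
    "(complex ^ 'n \<Rightarrow> complex ^ 'n \<Rightarrow> complex) \<Rightarrow> (complex ^ 'n) set \<Rightarrow> complex ^ 'n
      \<Rightarrow> (complex ^ 'n \<Rightarrow> complex)" where
  "restricted_functional \<beta> W v = (\<lambda>w. if w \<in> W then \<beta> v w else 0)"

definition form_rank ::
    "(complex ^ 'n \<Rightarrow> complex ^ 'n \<Rightarrow> complex) \<Rightarrow> (complex ^ 'n) set \<Rightarrow> (complex ^ 'n) set \<Rightarrow> nat" where
  "form_rank \<beta> V W = fun_space.dim (restricted_functional \<beta> W ` V)"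

section \<open>The flag variety and its Zariski topology\<close>

definition Fl :: "(nat \<Rightarrow> (complex ^ 'n) set) set" where
  "Fl = {F. F \<in> extensional {0..CARD('n)} \<and>
            (\<forall>i\<le>CARD('n). vec.subspace (F i) \<and> vec.dim (F i) = i) \<and>
            (\<forall>i<CARD('n). F i \<subset> F (Suc i))}"

text \<open>For \<open>i = length a\<close>, the coordinate at \<open>a\<close> of the alternating tensor
  \<open>b 0 \<and> \<dots> \<and> b (i - 1)\<close>: the minor of the matrix with columns
  \<open>b 0, \<dots>, b (i - 1)\<close> in the rows listed in \<open>a\<close>. The list \<open>a\<close> is arbitrary because
  \<open>'n\<close> carries no order; permuting \<open>a\<close> only changes the sign, and the coordinate is zero if
  \<open>a\<close> has a repetition (in particular if \<open>i > n\<close>).\<close>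

definition wedge_coord :: "(nat \<Rightarrow> complex ^ 'n) \<Rightarrow> 'n list \<Rightarrow> complex" where
  "wedge_coord b a =
     (\<Sum>\<sigma> | \<sigma> permutes {..<length a}. of_int (sign \<sigma>) * (\<Prod>r<length a. b r $ (a ! \<sigma> r)))"

text \<open>The Pluecker embedding of \<open>Fl\<close> into the product of the projective spaces of the exterior
  powers: all choices of homogeneous coordinates of the image of \<open>F\<close>. The coordinates belonging to
  the factor \<open>i\<close> are those indexed by lists of length \<open>i\<close>; they are computed from a
  basis \<open>b i 0, \<dots>, b i (i - 1)\<close> of \<open>F i\<close>, and the bases for different \<open>i\<close> are chosen
  independently, so that each factor can be rescaled separately.\<close>

definition pluecker_coords :: "(nat \<Rightarrow> (complex ^ 'n) set) \<Rightarrow> ('n list \<Rightarrow> complex) set" where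
  "pluecker_coords F =
     {(\<lambda>a. wedge_coord (b (length a)) a) | b. \<forall>i\<le>CARD('n). vec.span (b i ` {..<i}) = F i}"

text \<open>Polynomials over the infinite field of complex numbers, in variables indexed by \<open>'v\<close>,
  identified with polynomial functions.\<close>

inductive polynomial_fun :: "(('v \<Rightarrow> complex) \<Rightarrow> complex) \<Rightarrow> bool" where
  "polynomial_fun (\<lambda>p. c)"
| "polynomial_fun (\<lambda>p. p x)"
| "polynomial_fun f \<Longrightarrow> polynomial_fun g \<Longrightarrow> polynomial_fun (\<lambda>p. f p + g p)"
| "polynomial_fun f \<Longrightarrow> polynomial_fun g \<Longrightarrow> polynomial_fun (\<lambda>p. f p * g p)"

text \<open>A polynomial vanishes at a point of a product of projective spaces if it vanishes at all
  choices of homogeneous coordinates of the point, equivalently if all its multihomogeneous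
  components vanish there. Hence there is no need to require multihomogeneity.\<close>

definition zariski_closed :: "(nat \<Rightarrow> (complex ^ 'n) set) set \<Rightarrow> bool" where
  "zariski_closed Z \<longleftrightarrow>
     (\<exists>S. (\<forall>f\<in>S. polynomial_fun f) \<and>
          Z = {F \<in> Fl. \<forall>f\<in>S. \<forall>p\<in>pluecker_coords F. f p = 0})"

section \<open>Involutions and orbit closures\<close>

text \<open>Elements of \<open>S\<^sub>n\<close> are functions on \<open>nat\<close> fixing everything outside \<open>{1..n}\<close>.\<close>

definition I_O :: "nat \<Rightarrow> (nat \<Rightarrow> nat) set" where
  "I_O n = {y. y permutes {1..n} \<and> y = inv y}"

definition I_Sp :: "nat \<Rightarrow> (nat \<Rightarrow> nat) set" where
  "I_Sp n = {y \<in> I_O n. \<forall>i\<in>{1..n}. y i \<noteq> i}"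

definition rk :: "(nat \<Rightarrow> nat) \<Rightarrow> nat \<Rightarrow> nat \<Rightarrow> nat" where
  "rk y i j = card {t \<in> {1..i}. y t \<in> {1..j}}"

definition orbit ::
    "(complex ^ 'n \<Rightarrow> complex ^ 'n \<Rightarrow> complex) \<Rightarrow> (nat \<Rightarrow> nat) \<Rightarrow> (nat \<Rightarrow> (complex ^ 'n) set) set" where
  "orbit \<beta> y =
     {F \<in> Fl. \<forall>i\<in>{1..CARD('n)}. \<forall>j\<in>{1..CARD('n)}. form_rank \<beta> (F i) (F j) = rk y i j}"

definition orbit_closure ::
    "(complex ^ 'n \<Rightarrow> complex ^ 'n \<Rightarrow> complex) \<Rightarrow> (nat \<Rightarrow> nat) \<Rightarrow> (nat \<Rightarrow> (complex ^ 'n) set) set" where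
  "orbit_closure \<beta> y = zariski_closed hull orbit \<beta> y"

section \<open>Involution Rothe diagrams and essential sets\<close>

definition D_hat :: "(nat \<Rightarrow> nat) \<Rightarrow> (nat \<times> nat) set" where
  "D_hat y = {(i, j). 1 \<le> i \<and> 1 \<le> j \<and> j < y i \<and> i < y j \<and> j \<le> i}"

definition D_hat_FPF :: "(nat \<Rightarrow> nat) \<Rightarrow> (nat \<times> nat) set" where
  "D_hat_FPF y = {(i, j). 1 \<le> i \<and> 1 \<le> j \<and> j < y i \<and> i < y j \<and> j < i}"

definition Ess :: "(nat \<times> nat) set \<Rightarrow> (nat \<times> nat) set" where
  "Ess D = {(i, j). (i, j) \<in> D \<and> (i + 1, j) \<notin> D \<and> (i, j + 1) \<notin> D \<and> (i + 1, j + 1) \<notin> D}"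

end

theory Submission
  imports Defs "Jordan_Normal_Form.Determinant"
begin

text \<open>A rank condition is Zariski closed because the vectors of Pluecker coordinates in which all but
  one index is fixed span \<open>F i\<close>, so that it says that certain minors, polynomial in the coordinates,
  vanish. The conditions on the essential set imply all others by the usual argument with Rothe diagrams,
  parity taking care of the diagonal in the skew case.

  It remains to approximate a flag \<open>F\<close> satisfying all conditions by flags of the orbit. In a basis
  \<open>e\<close> adapted to \<open>F\<close> the form is given by a monomial matrix of an involution \<open>z\<close>.
  If \<open>z \<noteq> y\<close>, let \<open>a\<close> be the first place where they differ. Replacing \<open>e a\<close> by
  \<open>e a + x\<close> for a suitable small combination \<open>x\<close> of later basis vectors gives nearby flags that
  still satisfy all conditions, but have a larger rank somewhere, while no rank drops in the limit. So induction on
  the sum of the defects of the ranks applies. This avoids the Bruhat order on involutions. Zariski closed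
  sets are closed under limits of flags since polynomials are continuous.\<close>

text \<open>The difficulty is the choice of \<open>x\<close>. With \<open>p = z a\<close>, the new
  vector in position \<open>a\<close> should pair with a vector earlier than \<open>e p\<close>, but
  each new nonzero entry of the Gram matrix may push a rank above \<open>rk y\<close>. The index
  \<open>b\<close> is the first row after \<open>a\<close> in which \<open>z\<close> has an entry
  from column \<open>y a\<close> to column \<open>p - 1\<close>. Before row \<open>b\<close>,
  \<open>rk z\<close> stays below \<open>rk y\<close> by at least one on these columns, and, if
  \<open>a < y a\<close>, by at least two once the row index has also reached \<open>y a\<close>.
  These spare ranks are weighed against the number of extra rows and columns needed to cover the new
  entries; the case distinctions all come from this count. That no rank drops in the limit follows
  from closedness of rank conditions: a smaller bound that holds for infinitely many nearby flags
  would pass to \<open>F\<close>. Nearby flags are images of \<open>F\<close> under linear maps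
  tending to the identity, so flags need no topology of their own. The induction runs inside an
  arbitrary closed set containing the orbit, because closures are intersections of such
  sets.\<close>

no_notation Matrix.vec_index (infixl "$" 100)

section \<open>Minors\<close>

text \<open>The Leibniz sum of \<open>wedge_coord\<close> with entries indexed by numbers, so that
  the size \<open>k\<close> can vary within a proof.\<close>

definition detf :: "nat \<Rightarrow> (nat \<Rightarrow> nat \<Rightarrow> complex) \<Rightarrow> complex" where
  "detf k M = (\<Sum>\<sigma> | \<sigma> permutes {..<k}. of_int (sign \<sigma>) * (\<Prod>r<k. M r (\<sigma> r)))"

lemma wedge_coord_eq_detf: "wedge_coord b a = detf (length a) (\<lambda>r q. b r $ (a ! q))"
  by (simp add: wedge_coord_def detf_def)

lemma detf_eq_det: "detf k M = Determinant.det (mat k k (\<lambda>(i, j). M i j))"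
proof -
  have "\<sigma> i < k" if "\<sigma> permutes {0..<k}" "i < k" for \<sigma> i
    using permutes_in_image[OF that(1), of i] that(2) by simp
  then show ?thesis
    unfolding detf_def lessThan_atLeast0
    by (subst Determinant.det_def'[of _ k]) (auto intro!: sum.cong prod.cong)
qed

lemma detf_cong: "(\<And>i j. i < k \<Longrightarrow> j < k \<Longrightarrow> M i j = N i j) \<Longrightarrow> detf k M = detf k N"
  unfolding detf_eq_det by (rule arg_cong[of _ _ Determinant.det]) auto

lemma detf_transpose: "detf k (\<lambda>i j. M j i) = detf k M"
proof -
  have "Determinant.det (mat k k (\<lambda>(i, j). M j i)) = Determinant.det (transpose_mat (mat k k (\<lambda>(i, j). M i j)))"
    by (rule arg_cong[of _ _ Determinant.det]) auto
  then show ?thesis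
    unfolding detf_eq_det using Determinant.det_transpose[of "mat k k (\<lambda>(i, j). M i j)" k] by auto
qed

text \<open>The cofactors along column \<open>q\<close> ignore that column, so one choice of
  \<open>C\<close> serves every \<open>x\<close>.\<close>

lemma detf_column_expansion:
  assumes "q < k"
  obtains C where "\<And>x. detf k (\<lambda>i j. if j = q then x i else M i j) = (\<Sum>i<k. C i * x i)"
proof -
  let ?A = "\<lambda>x. mat k k (\<lambda>(i, j). if j = q then x i else M i j)"
  have *: "cofactor (?A x) i q = cofactor (?A y) i q" for x y i
  proof -
    have "mat_delete (?A x) i q = mat_delete (?A y) i q"
      by (auto simp: mat_delete_def)
    then show ?thesis by (simp add: cofactor_def)
  qed
  have c: "cofactor (?A x) i q = cofactor (?A (\<lambda>_. 0)) i q" for x i by (rule *)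
  have "detf k (\<lambda>i j. if j = q then x i else M i j) = (\<Sum>i<k. cofactor (?A (\<lambda>_. 0)) i q * x i)" for x
    unfolding detf_eq_det using assms c
    by (subst laplace_expansion_column[of _ k q]) (auto intro!: sum.cong)
  then show ?thesis by (rule that)
qed

text \<open>Inserting the last unit vector identifies \<open>C k\<close> as the complementary minor.
  That this coefficient is known is what allows a nonzero minor to be enlarged.\<close>

lemma detf_Suc_expansion:
  obtains C where "C k = detf k M"
    "\<And>x. detf (Suc k) (\<lambda>i j. if j = k then x i else M i j) = (\<Sum>i<Suc k. C i * x i)"
proof -
  obtain C where C: "\<And>x. detf (Suc k) (\<lambda>i j. if j = k then x i else M i j) = (\<Sum>i<Suc k. C i * x i)"
    using detf_column_expansion[of k "Suc k" M] by auto
  let ?A = "mat (Suc k) (Suc k) (\<lambda>(i, j). if j = k then (if i = k then 1 else 0) else M i j)"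
  have "C k = (\<Sum>i<Suc k. C i * (if i = k then 1 else 0))"
    by simp
  also have "\<dots> = Determinant.det ?A"
    unfolding C[symmetric] detf_eq_det by simp
  also have "\<dots> = (\<Sum>i<Suc k. ?A $$ (i, k) * cofactor ?A i k)"
    by (rule laplace_expansion_column) auto
  also have "\<dots> = cofactor ?A k k"
    by simp
  also have "\<dots> = detf k M"
    unfolding cofactor_def detf_eq_det mat_delete_def
    by (auto intro!: arg_cong[of _ _ Determinant.det])
  finally show ?thesis using C that by blast
qed

lemma detf_equal_columns:
  assumes "q < k" "q' < k" "q \<noteq> q'" "\<And>i. i < k \<Longrightarrow> M i q = M i q'"
  shows "detf k M = 0"
  unfolding detf_eq_det
  by (rule det_identical_columns[of _ k q q']) (use assms in \<open>auto intro!: eq_vecI\<close>)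

lemma detf_dependent_rows:
  assumes "r < k" "c r \<noteq> 0" "\<And>j. j < k \<Longrightarrow> (\<Sum>i<k. c i * M i j) = 0"
  shows "detf k M = 0"
proof -
  let ?A = "mat k k (\<lambda>(i, j). M j i)"
  let ?v = "Matrix.vec k c"
  have "?v \<noteq> 0\<^sub>v k" using assms(1,2) by (metis index_vec index_zero_vec(1))
  moreover have "?A *\<^sub>v ?v = 0\<^sub>v k"
    using assms(3) by (auto intro!: eq_vecI simp: scalar_prod_def lessThan_atLeast0 mult.commute)
  ultimately have "Determinant.det ?A = 0"
    by (subst det_0_iff_vec_prod_zero_field[of _ k]) (auto intro!: exI[of _ ?v])
  then show ?thesis
    using detf_transpose[of k M] unfolding detf_eq_det by simp
qed

section \<open>Independence of functions and nonvanishing minors\<close>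

lemma sum_fun_apply: "(\<Sum>i\<in>I. f i) x = (\<Sum>i\<in>I. f i x)"
  for f :: "'i \<Rightarrow> 'a \<Rightarrow> complex"
  by (induction I rule: infinite_finite_induct) auto

text \<open>Independence is a property of a set, whereas the rows of a minor form an indexed family;
  injectivity translates between the two.\<close>

lemma fun_independent_familyD:
  assumes "finite I" "inj_on g I" "fun_space.independent (g ` I)"
    and "\<And>x. (\<Sum>i\<in>I. c i * g i x) = 0" "i \<in> I"
  shows "c i = 0"
proof -
  let ?u = "\<lambda>f. c (the_inv_into I g f)"
  have "(\<Sum>f\<in>g ` I. (\<lambda>x. ?u f * f x)) = 0"
    using assms(2,4) by (auto simp: sum.reindex the_inv_into_f_f sum_fun_apply fun_eq_iff)
  then have "?u (g i) = 0"
    using fun_space.independentD[OF assms(3), of "g ` I" ?u "g i"] assms(1,5) by auto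
  then show ?thesis using assms(2,5) by (simp add: the_inv_into_f_f)
qed

lemma fun_independent_familyI:
  assumes "finite I"
    and *: "\<And>c. (\<And>x. (\<Sum>i\<in>I. c i * g i x) = 0) \<Longrightarrow> \<forall>i\<in>I. c i = 0"
  shows "inj_on g I" "fun_space.independent (g ` I)"
proof -
  show inj: "inj_on g I"
  proof (rule inj_onI, rule ccontr)
    fix i j assume ij: "i \<in> I" "j \<in> I" "g i = g j" "i \<noteq> j"
    have "(\<Sum>k\<in>I. (if k = i then 1 else if k = j then -1 else 0) * g k x) = 0" for x
    proof -
      have "(\<Sum>k\<in>I. (if k = i then 1 else if k = j then -1 else 0) * g k x)
        = (\<Sum>k\<in>{i, j}. (if k = i then 1 else if k = j then -1 else 0) * g k x)"
        using ij assms(1) by (intro sum.mono_neutral_right) auto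
      also have "\<dots> = 0" using ij by simp
      finally show ?thesis .
    qed
    from *[OF this] ij show False by auto
  qed
  show "fun_space.independent (g ` I)"
  proof (rule fun_space.independent_if_scalars_zero)
    show "finite (g ` I)" using assms(1) by simp
    fix u f assume s: "(\<Sum>f\<in>g ` I. (\<lambda>x. u f * f x)) = 0" and f: "f \<in> g ` I"
    have "(\<Sum>i\<in>I. u (g i) * g i x) = 0" for x
      using fun_cong[OF s, of x] inj by (simp add: sum.reindex sum_fun_apply)
    from *[OF this] f show "u f = 0" by auto
  qed
qed

text \<open>\<open>X\<close> separates the functions in the span. Columns are added one at a time:
  expanded along a new column, the minor is a combination of the \<open>g i\<close> whose last
  coefficient is the old nonzero minor. By independence this is a nonzero function, so it is nonzero
  at some point of \<open>X\<close>.\<close>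

lemma independent_imp_minor:
  assumes "inj_on g {..<k}" "fun_space.independent (g ` {..<k})"
    and "\<And>f. f \<in> fun_space.span (g ` {..<k}) \<Longrightarrow> (\<And>x. x \<in> X \<Longrightarrow> f x = 0) \<Longrightarrow> f = 0"
  shows "\<exists>x. (\<forall>q<k. x q \<in> X) \<and> detf k (\<lambda>p q. g p (x q)) \<noteq> 0"
  using assms
proof (induction k)
  case 0
  show ?case by (simp add: detf_def)
next
  case (Suc k)
  have sub: "g ` {..<k} \<subseteq> g ` {..<Suc k}" by auto
  have "\<exists>x. (\<forall>q<k. x q \<in> X) \<and> detf k (\<lambda>p q. g p (x q)) \<noteq> 0"
  proof (rule Suc.IH)
    show "inj_on g {..<k}" using Suc.prems(1) by (rule inj_on_subset) auto
    show "fun_space.independent (g ` {..<k})"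
      using Suc.prems(2) sub by (rule fun_space.independent_mono)
    show "f = 0" if "f \<in> fun_space.span (g ` {..<k})" "\<And>x. x \<in> X \<Longrightarrow> f x = 0" for f
      using Suc.prems(3) that fun_space.span_mono[OF sub] by blast
  qed
  then obtain x where x: "\<And>q. q < k \<Longrightarrow> x q \<in> X" "detf k (\<lambda>p q. g p (x q)) \<noteq> 0" by blast
  obtain C where C: "C k = detf k (\<lambda>p q. g p (x q))"
    "\<And>z. detf (Suc k) (\<lambda>i j. if j = k then z i else g i (x j)) = (\<Sum>i<Suc k. C i * z i)"
    by (rule detf_Suc_expansion[of k "\<lambda>p q. g p (x q)"]) (rule that)
  let ?f = "\<Sum>i<Suc k. (\<lambda>x. C i * g i x)"
  have "?f \<in> fun_space.span (g ` {..<Suc k})"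
    by (intro fun_space.span_sum fun_space.span_scale fun_space.span_base) auto
  moreover have "?f \<noteq> 0"
  proof
    assume "?f = 0"
    then have "(\<Sum>i<Suc k. C i * g i x) = 0" for x
      by (metis (no_types, lifting) sum_fun_apply zero_fun_def sum.cong)
    from fun_independent_familyD[OF _ Suc.prems(1,2) this, of k] C(1) x(2) show False by auto
  qed
  ultimately obtain w where w: "w \<in> X" "?f w \<noteq> 0" using Suc.prems(3) by blast
  have "detf (Suc k) (\<lambda>p q. g p ((x(k := w)) q)) = (\<Sum>i<Suc k. C i * g i w)"
    unfolding C(2)[symmetric] by (rule detf_cong) auto
  then have "detf (Suc k) (\<lambda>p q. g p ((x(k := w)) q)) \<noteq> 0"
    using w(2) by (simp add: sum_fun_apply)
  then show ?case using x(1) w(1) by (intro exI[of _ "x(k := w)"]) auto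
qed

lemma minor_imp_independent:
  assumes "detf k (\<lambda>p q. g p (x q)) \<noteq> 0"
  shows "inj_on g {..<k}" "fun_space.independent (g ` {..<k})"
proof -
  have *: "\<forall>i\<in>{..<k}. c i = 0" if "\<And>x. (\<Sum>i<k. c i * g i x) = 0" for c
  proof (rule ccontr)
    assume "\<not> ?thesis"
    then obtain r where "r < k" "c r \<noteq> 0" by auto
    then have "detf k (\<lambda>p q. g p (x q)) = 0"
      using that by (intro detf_dependent_rows[of r k c]) auto
    then show False using assms by simp
  qed
  show "inj_on g {..<k}" "fun_space.independent (g ` {..<k})"
    using fun_independent_familyI[of "{..<k}" g, OF _ *] by auto
qed

text \<open>Rows range over generators and columns over a separating set, so that rank bounds can be
  tested on arbitrary spanning sets.\<close>

lemma le_fun_dim_iff_minor: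
  assumes "finite G"
    and "\<And>f. f \<in> fun_space.span G \<Longrightarrow> (\<And>x. x \<in> X \<Longrightarrow> f x = 0) \<Longrightarrow> f = 0"
  shows "k \<le> fun_space.dim G \<longleftrightarrow>
    (\<exists>g x. (\<forall>p<k. g p \<in> G) \<and> (\<forall>q<k. x q \<in> X) \<and> detf k (\<lambda>p q. g p (x q)) \<noteq> 0)"
proof
  assume k: "k \<le> fun_space.dim G"
  obtain B where B: "B \<subseteq> G" "fun_space.independent B" "G \<subseteq> fun_space.span B"
    "card B = fun_space.dim G"
    by (rule fun_space.basis_exists)
  obtain g where g: "bij_betw g {..<card B} B"
    using ex_bij_betw_nat_finite[of B] finite_subset[OF B(1) assms(1)]
    by (auto simp: lessThan_atLeast0)
  have kB: "{..<k} \<subseteq> {..<card B}" using k B(4) by simp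
  have img: "g ` {..<k} \<subseteq> B" using g kB by (auto simp: bij_betw_def)
  have "\<exists>x. (\<forall>q<k. x q \<in> X) \<and> detf k (\<lambda>p q. g p (x q)) \<noteq> 0"
  proof (rule independent_imp_minor)
    show "inj_on g {..<k}" using g kB by (auto simp: bij_betw_def intro: inj_on_subset)
    show "fun_space.independent (g ` {..<k})" using B(2) img by (rule fun_space.independent_mono)
    show "f = 0" if "f \<in> fun_space.span (g ` {..<k})" "\<And>x. x \<in> X \<Longrightarrow> f x = 0" for f
      using assms(2) that fun_space.span_mono[of "g ` {..<k}" G] img B(1) by blast
  qed
  then obtain x where x: "\<forall>q<k. x q \<in> X" "detf k (\<lambda>p q. g p (x q)) \<noteq> 0" by blast
  show "\<exists>g x. (\<forall>p<k. g p \<in> G) \<and> (\<forall>q<k. x q \<in> X) \<and> detf k (\<lambda>p q. g p (x q)) \<noteq> 0"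
    using img B(1) x by (intro exI[of _ g] exI[of _ x]) auto
next
  assume "\<exists>g x. (\<forall>p<k. g p \<in> G) \<and> (\<forall>q<k. x q \<in> X) \<and> detf k (\<lambda>p q. g p (x q)) \<noteq> 0"
  then obtain g x where g: "\<forall>p<k. g p \<in> G" "detf k (\<lambda>p q. g p (x q)) \<noteq> 0" by blast
  note ind = minor_imp_independent[of k g x, OF g(2)]
  obtain B where B: "B \<subseteq> G" "fun_space.independent B" "G \<subseteq> fun_space.span B"
    "card B = fun_space.dim G"
    by (rule fun_space.basis_exists)
  have "g ` {..<k} \<subseteq> fun_space.span B" using g(1) B(3) by auto
  then have "card (g ` {..<k}) \<le> card B"
    using fun_space.independent_span_bound[OF finite_subset[OF B(1) assms(1)] ind(2)] by simp
  then show "k \<le> fun_space.dim G" using B(4) ind(1) by (simp add: card_image)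
qed

section \<open>Ranks of a form on subspaces\<close>

lemma detf_scale: "detf k (\<lambda>i j. c * M i j) = c ^ k * detf k M"
  by (simp add: detf_def prod.distrib sum_distrib_left mult_ac)

lemma fun_dim_mono:
  assumes "G \<subseteq> fun_space.span H" "finite H"
  shows "fun_space.dim G \<le> fun_space.dim H"
proof -
  obtain B where B: "B \<subseteq> H" "H \<subseteq> fun_space.span B" "card B = fun_space.dim H"
    by (rule fun_space.basis_exists)
  have "G \<subseteq> fun_space.span B"
    using assms(1) B(2) fun_space.span_mono[OF B(2)] by (simp add: fun_space.span_span)
  then show ?thesis
    using fun_space.dim_le_card[of G B] B finite_subset[OF B(1) assms(2)] by simp
qed

lemma fun_dim_insert_le:
  assumes "finite H"
  shows "fun_space.dim (insert f H) \<le> Suc (fun_space.dim H)"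
proof -
  obtain B where B: "B \<subseteq> H" "H \<subseteq> fun_space.span B" "card B = fun_space.dim H"
    by (rule fun_space.basis_exists)
  have fB: "finite B" using B(1) assms finite_subset by blast
  have "insert f H \<subseteq> fun_space.span (insert f B)"
    using B(2) fun_space.span_mono[of B "insert f B"] fun_space.span_base[of f "insert f B"] by auto
  then have "fun_space.dim (insert f H) \<le> card (insert f B)"
    using fB by (intro fun_space.dim_le_card) auto
  also have "\<dots> \<le> Suc (card B)" using fB by (simp add: card_insert_if)
  finally show ?thesis using B(3) by simp
qed

lemma subspace_finite_span:
  fixes V :: "(complex ^ 'n) set"
  assumes "vec.subspace V"
  obtains A where "finite A" "V = vec.span A"
proof -
  obtain A where "A \<subseteq> V" "vec.independent A" "V \<subseteq> vec.span A"
    by (rule vec.basis_exists)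
  then have "finite A" "V = vec.span A"
    using assms vec.finiteI_independent vec.span_subspace by blast+
  then show ?thesis using that by blast
qed

text \<open>The sign \<open>\<epsilon>\<close> treats the symmetric and the skew case at
  once.\<close>

locale eps_form =
  fixes \<beta> :: "complex ^ 'n \<Rightarrow> complex ^ 'n \<Rightarrow> complex" and \<epsilon> :: complex
  assumes bilinear: "bilinear_form \<beta>" and nondeg: "nondegenerate \<beta>"
    and eps_sym: "\<beta> v w = \<epsilon> * \<beta> w v" and eps: "\<epsilon> = 1 \<or> \<epsilon> = -1"
begin

lemma lin_left: "Vector_Spaces.linear (*s) (*) (\<lambda>v. \<beta> v w)"
  and lin_right: "Vector_Spaces.linear (*s) (*) (\<lambda>w. \<beta> v w)"
  using bilinear by (auto simp: bilinear_form_def)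

lemma form_simps [simp]:
  "\<beta> (v + v') w = \<beta> v w + \<beta> v' w" "\<beta> (c *s v) w = c * \<beta> v w" "\<beta> 0 w = 0"
  "\<beta> v (w + w') = \<beta> v w + \<beta> v w'" "\<beta> v (c *s w) = c * \<beta> v w" "\<beta> v 0 = 0"
proof -
  interpret l: Vector_Spaces.linear "(*s)" "(*)" "\<lambda>v. \<beta> v w" by (rule lin_left)
  interpret r: Vector_Spaces.linear "(*s)" "(*)" "\<lambda>w. \<beta> v w" by (rule lin_right)
  show "\<beta> (v + v') w = \<beta> v w + \<beta> v' w" "\<beta> (c *s v) w = c * \<beta> v w" "\<beta> 0 w = 0"
    using l.add l.scale l.zero by blast+
  show "\<beta> v (w + w') = \<beta> v w + \<beta> v w'" "\<beta> v (c *s w) = c * \<beta> v w" "\<beta> v 0 = 0"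
    using r.add r.scale r.zero by blast+
qed

lemma form_diff [simp]:
  "\<beta> (v - v') w = \<beta> v w - \<beta> v' w" "\<beta> v (w - w') = \<beta> v w - \<beta> v w'"
proof -
  have "v - v' = v + (-1) *s v'" "w - w' = w + (-1) *s w'" by (simp_all add: vec_eq_iff)
  then show "\<beta> (v - v') w = \<beta> v w - \<beta> v' w" "\<beta> v (w - w') = \<beta> v w - \<beta> v w'"
    by (simp_all only: form_simps) simp_all
qed

lemma form_sum:
  "\<beta> (\<Sum>i\<in>I. f i) w = (\<Sum>i\<in>I. \<beta> (f i) w)" "\<beta> v (\<Sum>i\<in>I. f i) = (\<Sum>i\<in>I. \<beta> v (f i))"
  by (induction I rule: infinite_finite_induct) auto

lemma form_zero_sym: "\<beta> v w = 0 \<longleftrightarrow> \<beta> w v = 0"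
  using eps_sym[of v w] eps by auto

lemma form_zero_span:
  assumes "\<And>w. w \<in> B \<Longrightarrow> \<beta> v w = 0" "w \<in> vec.span B"
  shows "\<beta> v w = 0"
  using assms(2) by (induction rule: vec.span_induct_alt) (use assms(1) in auto)

lemma linear_restricted_functional:
  assumes "vec.subspace W"
  shows "Vector_Spaces.linear (*s) (\<lambda>c f x. c * f x) (restricted_functional \<beta> W)"
  by unfold_locales (auto simp: restricted_functional_def fun_eq_iff)

lemma restricted_functional_span:
  assumes "vec.subspace W"
  shows "restricted_functional \<beta> W ` vec.span A = fun_space.span (restricted_functional \<beta> W ` A)"
  using module_hom.span_image[OF linear_restricted_functional[OF assms, unfolded linear_iff_module_hom], of A] ..

lemma form_rank_span:
  assumes "vec.subspace W"
  shows "form_rank \<beta> (vec.span A) W = fun_space.dim (restricted_functional \<beta> W ` A)"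
  unfolding form_rank_def restricted_functional_span[OF assms] by simp

text \<open>A functional on the span of \<open>B\<close> is determined by its values on
  \<open>B\<close>, so \<open>B\<close> is a separating set. Spanning sets rather than bases are
  what Pluecker coordinates provide.\<close>

lemma le_form_rank_iff_minor:
  assumes "finite A"
  shows "k \<le> form_rank \<beta> (vec.span A) (vec.span B) \<longleftrightarrow>
    (\<exists>v w. (\<forall>p<k. v p \<in> A) \<and> (\<forall>q<k. w q \<in> B) \<and> detf k (\<lambda>p q. \<beta> (v p) (w q)) \<noteq> 0)"
proof -
  let ?R = "restricted_functional \<beta> (vec.span B)"
  have "f = 0" if f: "f \<in> fun_space.span (?R ` A)" "\<And>x. x \<in> B \<Longrightarrow> f x = 0" for f
  proof -
    from f(1) obtain v where v: "f = ?R v"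
      unfolding restricted_functional_span[OF vec.subspace_span, symmetric] by auto
    have "\<beta> v w = 0" if "w \<in> B" for w
      using f(2)[OF that] v that vec.span_base[OF that] by (simp add: restricted_functional_def)
    then show ?thesis
      unfolding v using form_zero_span[of B v]
      by (auto simp: restricted_functional_def fun_eq_iff)
  qed
  note le_fun_dim_iff_minor[of "?R ` A" B k, OF finite_imageI[OF assms] this]
  then have "k \<le> form_rank \<beta> (vec.span A) (vec.span B) \<longleftrightarrow>
    (\<exists>g x. (\<forall>p<k. g p \<in> ?R ` A) \<and> (\<forall>q<k. x q \<in> B) \<and> detf k (\<lambda>p q. g p (x q)) \<noteq> 0)"
    unfolding form_rank_span[OF vec.subspace_span] .
  also have "\<dots> \<longleftrightarrow> (\<exists>v w. (\<forall>p<k. v p \<in> A) \<and> (\<forall>q<k. w q \<in> B) \<and> detf k (\<lambda>p q. \<beta> (v p) (w q)) \<noteq> 0)"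
    (is "?l \<longleftrightarrow> ?r")
  proof
    assume ?l
    then obtain g x where g: "\<forall>p<k. g p \<in> ?R ` A" "\<forall>q<k. x q \<in> B" "detf k (\<lambda>p q. g p (x q)) \<noteq> 0"
      by blast
    from g(1) have "\<forall>p. \<exists>v. p < k \<longrightarrow> v \<in> A \<and> g p = ?R v" by auto
    then obtain v where v: "\<And>p. p < k \<Longrightarrow> v p \<in> A \<and> g p = ?R (v p)" by metis
    have "detf k (\<lambda>p q. g p (x q)) = detf k (\<lambda>p q. \<beta> (v p) (x q))"
      using v g(2) by (intro detf_cong) (auto simp: restricted_functional_def vec.span_base)
    then show ?r using v g by metis
  next
    assume ?r
    then obtain v w where v: "\<forall>p<k. v p \<in> A" "\<forall>q<k. w q \<in> B" "detf k (\<lambda>p q. \<beta> (v p) (w q)) \<noteq> 0"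
      by blast
    have "detf k (\<lambda>p q. ?R (v p) (w q)) = detf k (\<lambda>p q. \<beta> (v p) (w q))"
      using v by (intro detf_cong) (auto simp: restricted_functional_def vec.span_base)
    then show ?l using v by (intro exI[of _ "\<lambda>p. ?R (v p)"] exI[of _ w]) auto
  qed
  finally show ?thesis .
qed

text \<open>Exchanging the arguments transposes a minor of size \<open>k\<close> and multiplies it
  by \<open>\<epsilon> ^ k\<close>, so the same minors are nonzero.\<close>

lemma form_rank_commute:
  assumes "vec.subspace V" "vec.subspace W"
  shows "form_rank \<beta> V W = form_rank \<beta> W V"
proof -
  obtain A where A: "finite A" "V = vec.span A" by (rule subspace_finite_span[OF assms(1)])
  obtain B where B: "finite B" "W = vec.span B" by (rule subspace_finite_span[OF assms(2)])
  have "detf k (\<lambda>p q. \<beta> (v p) (w q)) = \<epsilon> ^ k * detf k (\<lambda>p q. \<beta> (w p) (v q))" for k v w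
    unfolding detf_scale[symmetric] detf_transpose[of k "\<lambda>p q. \<beta> (v p) (w q)", symmetric]
    by (rule detf_cong) (rule eps_sym)
  moreover have "\<epsilon> ^ k \<noteq> 0" for k using eps by auto
  ultimately have "detf k (\<lambda>p q. \<beta> (v p) (w q)) \<noteq> 0 \<longleftrightarrow> detf k (\<lambda>p q. \<beta> (w p) (v q)) \<noteq> 0" for k v w
    by (metis mult_eq_0_iff)
  then have "k \<le> form_rank \<beta> V W \<longleftrightarrow> k \<le> form_rank \<beta> W V" for k
    unfolding A(2) B(2) le_form_rank_iff_minor[OF A(1)] le_form_rank_iff_minor[OF B(1)] by metis
  then show ?thesis by (meson order_antisym order_refl)
qed

lemma form_rank_insert_left:
  assumes "finite A" "vec.subspace W"
  shows "form_rank \<beta> (vec.span (insert x A)) W \<le> Suc (form_rank \<beta> (vec.span A) W)"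
  using fun_dim_insert_le[of "restricted_functional \<beta> W ` A" "restricted_functional \<beta> W x"] assms
  by (simp add: form_rank_span)

lemma form_rank_insert_right:
  assumes "finite B" "vec.subspace V"
  shows "form_rank \<beta> V (vec.span (insert x B)) \<le> Suc (form_rank \<beta> V (vec.span B))"
  using form_rank_insert_left[OF assms] form_rank_commute assms by (metis vec.subspace_span)

lemma form_rank_zero:
  assumes "\<And>v w. v \<in> A \<Longrightarrow> w \<in> B \<Longrightarrow> \<beta> v w = 0"
  shows "form_rank \<beta> (vec.span A) (vec.span B) = 0"
proof -
  have "restricted_functional \<beta> (vec.span B) ` A \<subseteq> {0}"
    using form_zero_span[of B] assms by (auto simp: restricted_functional_def fun_eq_iff)
  then have "fun_space.dim (restricted_functional \<beta> (vec.span B) ` A) \<le> card ({} :: (complex ^ 'n \<Rightarrow> complex) set)"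
    by (intro fun_space.dim_le_card) auto
  then show ?thesis by (simp add: form_rank_span)
qed

text \<open>A line cover of the Gram matrix: every nonzero entry lies in a row of \<open>I'\<close>
  or a column of \<open>J'\<close>, and each of these lines adds at most one to the rank. Ranks of
  moved flags are bounded by choosing such covers.\<close>

lemma form_rank_cover:
  assumes "finite I" "finite J" "I' \<subseteq> I" "J' \<subseteq> J"
    and "\<And>i j. i \<in> I - I' \<Longrightarrow> j \<in> J - J' \<Longrightarrow> \<beta> (v i) (w j) = 0"
  shows "form_rank \<beta> (vec.span (v ` I)) (vec.span (w ` J)) \<le> card I' + card J'"
proof -
  have "finite I'" using assms finite_subset by blast
  then have 1: "form_rank \<beta> (vec.span (v ` I' \<union> A)) W \<le> card I' + form_rank \<beta> (vec.span A) W"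
    if "finite A" "vec.subspace W" for A W
  proof induction
    case (insert x F)
    then show ?case
      using form_rank_insert_left[of "v ` F \<union> A" W "v x"] that by auto
  qed simp
  have "finite J'" using assms finite_subset by blast
  then have 2: "form_rank \<beta> V (vec.span (w ` J' \<union> B)) \<le> card J' + form_rank \<beta> V (vec.span B)"
    if "finite B" "vec.subspace V" for B V
  proof induction
    case (insert x F)
    then show ?case
      using form_rank_insert_right[of "w ` F \<union> B" V "w x"] that by auto
  qed simp
  have I: "v ` I = v ` I' \<union> v ` (I - I')" and J: "w ` J = w ` J' \<union> w ` (J - J')"
    using assms by auto
  have "form_rank \<beta> (vec.span (v ` I)) (vec.span (w ` J))
    \<le> card I' + form_rank \<beta> (vec.span (v ` (I - I'))) (vec.span (w ` J))"
    unfolding I using assms by (intro 1) auto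
  also have "form_rank \<beta> (vec.span (v ` (I - I'))) (vec.span (w ` J))
    \<le> card J' + form_rank \<beta> (vec.span (v ` (I - I'))) (vec.span (w ` (J - J')))"
    unfolding J using assms by (intro 2) auto
  also have "form_rank \<beta> (vec.span (v ` (I - I'))) (vec.span (w ` (J - J'))) = 0"
    using assms by (intro form_rank_zero) auto
  finally show ?thesis by simp
qed

text \<open>A diagonal block of the Gram matrix without zeros on its diagonal makes the functionals
  of the \<open>v x\<close> independent.\<close>

lemma card_le_form_rank:
  assumes "finite X" "vec.subspace V" "vec.subspace W"
    and "\<And>x. x \<in> X \<Longrightarrow> v x \<in> V" "\<And>x. x \<in> X \<Longrightarrow> w x \<in> W"
    and "\<And>x y. x \<in> X \<Longrightarrow> y \<in> X \<Longrightarrow> \<beta> (v x) (w y) \<noteq> 0 \<longleftrightarrow> x = y"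
  shows "card X \<le> form_rank \<beta> V W"
proof -
  let ?R = "restricted_functional \<beta> W"
  have *: "\<forall>x\<in>X. c x = 0" if "\<And>z. (\<Sum>x\<in>X. c x * ?R (v x) z) = 0" for c
  proof
    fix y assume y: "y \<in> X"
    have "(\<Sum>x\<in>X. c x * ?R (v x) (w y)) = (\<Sum>x\<in>X. if x = y then c y * \<beta> (v y) (w y) else 0)"
      using assms(5,6) y by (intro sum.cong) (auto simp: restricted_functional_def)
    also have "\<dots> = c y * \<beta> (v y) (w y)" using y assms(1) by simp
    finally show "c y = 0" using that[of "w y"] assms(6)[OF y y] by simp
  qed
  note ind = fun_independent_familyI[of X "\<lambda>x. ?R (v x)", OF assms(1) *]
  obtain A where A: "finite A" "V = vec.span A" by (rule subspace_finite_span[OF assms(2)])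
  have "card X = card ((\<lambda>x. ?R (v x)) ` X)" using ind(1) by (simp add: card_image)
  also have "\<dots> = fun_space.dim ((\<lambda>x. ?R (v x)) ` X)"
    using ind(2) by (simp add: fun_space.dim_eq_card_independent)
  also have "\<dots> \<le> fun_space.dim (?R ` A)"
    using assms(4) A restricted_functional_span[OF assms(3), of A] by (intro fun_dim_mono) auto
  also have "\<dots> = form_rank \<beta> V W" using A(2) assms(3) by (simp add: form_rank_span)
  finally show ?thesis .
qed

end

section \<open>Closedness of rank conditions\<close>

lemma polynomial_fun_sum:
  "finite I \<Longrightarrow> (\<And>i. i \<in> I \<Longrightarrow> polynomial_fun (f i)) \<Longrightarrow> polynomial_fun (\<lambda>p. \<Sum>i\<in>I. f i p)"
  by (induction I rule: finite_induct) (auto intro: polynomial_fun.intros)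

lemma polynomial_fun_prod:
  "finite I \<Longrightarrow> (\<And>i. i \<in> I \<Longrightarrow> polynomial_fun (f i)) \<Longrightarrow> polynomial_fun (\<lambda>p. \<Prod>i\<in>I. f i p)"
  by (induction I rule: finite_induct) (auto intro: polynomial_fun.intros)

lemma polynomial_fun_detf:
  "(\<And>i j. i < k \<Longrightarrow> j < k \<Longrightarrow> polynomial_fun (M i j)) \<Longrightarrow> polynomial_fun (\<lambda>p. detf k (\<lambda>i j. M i j p))"
proof -
  assume *: "\<And>i j. i < k \<Longrightarrow> j < k \<Longrightarrow> polynomial_fun (M i j)"
  have "\<sigma> r < k" if "\<sigma> permutes {..<k}" "r < k" for \<sigma> r
    using permutes_in_image[OF that(1), of r] that(2) by simp
  then show ?thesis
    unfolding detf_def using *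
    by (intro polynomial_fun_sum polynomial_fun.intros polynomial_fun_prod)
       (auto simp: finite_permutations)
qed

lemma continuous_polynomial_fun:
  assumes "polynomial_fun f" "\<And>a. (\<lambda>m. P m a) \<longlonglongrightarrow> p a"
  shows "(\<lambda>m. f (P m)) \<longlonglongrightarrow> f p"
  using assms(1) by (induction) (auto intro: tendsto_intros assms(2))

text \<open>\<open>Fl\<close> is kept as a separate condition so that the empty family gives all of
  \<open>Fl\<close>.\<close>

lemma zariski_closed_Int:
  assumes "\<And>Z. Z \<in> \<Z> \<Longrightarrow> zariski_closed Z"
  shows "zariski_closed {F \<in> Fl. \<forall>Z\<in>\<Z>. F \<in> Z}"
proof -
  have "\<forall>Z\<in>\<Z>. \<exists>S. (\<forall>f\<in>S. polynomial_fun f) \<and> Z = {F \<in> Fl. \<forall>f\<in>S. \<forall>p\<in>pluecker_coords F. f p = 0}"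
    using assms unfolding zariski_closed_def by blast
  from bchoice[OF this] obtain S where S: "\<forall>Z\<in>\<Z>. (\<forall>f\<in>S Z. polynomial_fun f) \<and>
    Z = {F \<in> Fl. \<forall>f\<in>S Z. \<forall>p\<in>pluecker_coords F. f p = 0}"
    by (rule exE)
  show ?thesis
    unfolding zariski_closed_def
  proof (intro exI[of _ "\<Union>Z\<in>\<Z>. S Z"] conjI)
    show "\<forall>f\<in>\<Union> (S ` \<Z>). polynomial_fun f" using S by auto
    have "F \<in> Z \<longleftrightarrow> (\<forall>f\<in>S Z. \<forall>p\<in>pluecker_coords F. f p = 0)" if "F \<in> Fl" "Z \<in> \<Z>" for F Z
      using arg_cong[OF conjunct2[OF bspec[OF S that(2)]], of "\<lambda>Z. F \<in> Z"] that(1) by simp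
    then show "{F \<in> Fl. \<forall>Z\<in>\<Z>. F \<in> Z} = {F \<in> Fl. \<forall>f\<in>\<Union> (S ` \<Z>). \<forall>p\<in>pluecker_coords F. f p = 0}"
      by auto
  qed
qed

section \<open>Recovering a flag from its Pluecker coordinates\<close>

lemma wedge_coord_update:
  assumes "s < length a"
  obtains C where "\<And>x. wedge_coord b (a[s := x]) = (\<Sum>r<length a. C r * b r $ x)"
proof -
  let ?i = "length a"
  obtain C where C: "\<And>x. detf ?i (\<lambda>i j. if j = s then x i else b i $ (a ! j)) = (\<Sum>r<?i. C r * x r)"
    by (rule detf_column_expansion[OF assms, of "\<lambda>i j. b i $ (a ! j)"]) (rule that)
  have "wedge_coord b (a[s := x]) = (\<Sum>r<?i. C r * b r $ x)" for x
    unfolding C[symmetric] wedge_coord_eq_detf length_list_update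
    using assms by (intro detf_cong) (auto simp: nth_list_update)
  then show ?thesis by (rule that)
qed

lemma wedge_coord_repeated:
  assumes "s < length a" "t < length a" "s \<noteq> t"
  shows "wedge_coord b (a[s := a ! t]) = 0"
  unfolding wedge_coord_eq_detf length_list_update
  by (rule detf_equal_columns[of s _ t]) (use assms in \<open>auto simp: nth_list_update\<close>)

text \<open>Contraction of the alternating tensor \<open>p\<close> with coordinate functionals in
  all slots except \<open>s\<close>; this leaves a vector of the subspace that \<open>p\<close>
  represents.\<close>

definition pluecker_vec :: "('n list \<Rightarrow> complex) \<Rightarrow> 'n list \<Rightarrow> nat \<Rightarrow> complex ^ 'n" where
  "pluecker_vec p a s = (\<chi> x. p (a[s := x]))"

lemma basis_wedge_coord_nonzero:
  fixes b :: "nat \<Rightarrow> complex ^ 'n"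
  assumes "inj_on b {..<i}" "vec.independent (b ` {..<i})"
  obtains a where "length a = i" "wedge_coord b a \<noteq> 0"
proof -
  let ?g = "\<lambda>r. ($) (b r)"
  have *: "\<forall>r\<in>{..<i}. c r = 0" if "\<And>x. (\<Sum>r<i. c r * ?g r x) = 0" for c
  proof
    fix r assume r: "r \<in> {..<i}"
    let ?u = "\<lambda>v. c (the_inv_into {..<i} b v)"
    have "(\<Sum>v\<in>b ` {..<i}. ?u v *s v) = 0"
      using assms(1) that by (simp add: sum.reindex the_inv_into_f_f) (simp add: Finite_Cartesian_Product.vec_eq_iff sum_component)
    from vec.independentD[OF assms(2) _ _ this, of "b r"] r assms(1)
    show "c r = 0" by (simp add: the_inv_into_f_f)
  qed
  note ind = fun_independent_familyI[of "{..<i}" ?g, OF _ *]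
  have "\<exists>x. (\<forall>q<i. x q \<in> UNIV) \<and> detf i (\<lambda>p q. ?g p (x q)) \<noteq> 0"
    by (rule independent_imp_minor) (use ind in \<open>auto simp: fun_eq_iff\<close>)
  then obtain x where "detf i (\<lambda>p q. b p $ (x q)) \<noteq> 0" by blast
  moreover have "wedge_coord b (map x [0..<i]) = detf i (\<lambda>p q. b p $ (x q))"
    unfolding wedge_coord_eq_detf by (auto intro!: detf_cong)
  ultimately show ?thesis using that[of "map x [0..<i]"] by simp
qed

text \<open>Expansion along the free position puts the vectors into the span. For a list
  \<open>a\<close> with nonzero coordinate, the vectors with free positions \<open>s < i\<close>
  form a multiple of the identity matrix in the rows of \<open>a\<close>, since off the diagonal a
  list entry is repeated. So \<open>i\<close> of them are independent, and the dimension does the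
  rest.\<close>

lemma span_pluecker_vec:
  fixes b :: "nat \<Rightarrow> complex ^ 'n"
  assumes "vec.dim (vec.span (b ` {..<i})) = i"
  shows "vec.span {pluecker_vec (wedge_coord b) a s | a s. length a = i \<and> s < i} = vec.span (b ` {..<i})"
    (is "vec.span ?P = ?V")
proof -
  have ind: "inj_on b {..<i}" "vec.independent (b ` {..<i})"
  proof -
    have "i \<le> card (b ` {..<i})" using assms vec.dim_le_card'[of "b ` {..<i}"] by simp
    then have c: "card (b ` {..<i}) = card {..<i}" using card_image_le[of "{..<i}" b] by simp
    then show "inj_on b {..<i}" by (intro eq_card_imp_inj_on) auto
    show "vec.independent (b ` {..<i})"
      using assms c by (intro vec.card_le_dim_spanning[of _ "vec.span (b ` {..<i})"]) (auto simp: vec.span_base)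
  qed
  have in_V: "pluecker_vec (wedge_coord b) a s \<in> ?V" if "length a = i" "s < i" for a s
  proof -
    have "s < length a" using that by simp
    then obtain C where C: "\<And>x. wedge_coord b (a[s := x]) = (\<Sum>r<length a. C r * b r $ x)"
      by (rule wedge_coord_update[of s a b]) (rule that)
    have "pluecker_vec (wedge_coord b) a s = (\<Sum>r<i. C r *s b r)"
      using that by (simp add: pluecker_vec_def C Finite_Cartesian_Product.vec_eq_iff)
    also have "\<dots> \<in> ?V"
      by (intro vec.span_sum vec.span_scale vec.span_base) auto
    finally show ?thesis .
  qed
  then have sub: "?P \<subseteq> ?V" by auto
  obtain a where a: "length a = i" "wedge_coord b a \<noteq> 0"
    by (rule basis_wedge_coord_nonzero[OF ind])
  let ?v = "pluecker_vec (wedge_coord b) a"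
  have v: "?v s $ (a ! t) = (if s = t then wedge_coord b a else 0)" if "s < i" "t < i" for s t
    using that a(1) wedge_coord_repeated[of s a t b] by (auto simp: pluecker_vec_def)
  have inj: "inj_on ?v {..<i}"
  proof (rule inj_onI, rule ccontr)
    fix s t assume "s \<in> {..<i}" "t \<in> {..<i}" "?v s = ?v t" "s \<noteq> t"
    then show False using v[of s s] v[of t s] a(2) by simp
  qed
  have ind_v: "vec.independent (?v ` {..<i})"
  proof (rule vec.independent_if_scalars_zero)
    fix u w assume s: "(\<Sum>w\<in>?v ` {..<i}. u w *s w) = 0" and "w \<in> ?v ` {..<i}"
    then obtain t where t: "t < i" "w = ?v t" by auto
    have "0 = (\<Sum>s<i. u (?v s) *s ?v s) $ (a ! t)"
      using s inj by (simp add: sum.reindex)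
    also have "\<dots> = (\<Sum>s<i. if s = t then u (?v t) * wedge_coord b a else 0)"
      unfolding sum_component using t v by (intro sum.cong) auto
    also have "\<dots> = u w * wedge_coord b a" using t by simp
    finally show "u w = 0" using a(2) by simp
  qed auto
  have sub': "?v ` {..<i} \<subseteq> ?V" using in_V a(1) by auto
  have "?V \<subseteq> vec.span (?v ` {..<i})"
    by (rule vec.card_ge_dim_independent[OF sub' ind_v]) (use inj assms in \<open>simp_all add: card_image\<close>)
  also have "\<dots> \<subseteq> vec.span ?P" using a(1) by (intro vec.span_mono) auto
  finally show ?thesis using sub vec.span_mono[OF sub] by (simp add: vec.span_span subset_antisym)
qed

lemma FlD:
  fixes F :: "nat \<Rightarrow> (complex ^ 'n) set"
  assumes "F \<in> Fl" "i \<le> CARD('n)"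
  shows "vec.subspace (F i)" "vec.dim (F i) = i"
  using assms by (auto simp: Fl_def)

text \<open>Vanishing at a flag is a condition on all of its coordinate vectors; existence of one
  keeps it from holding vacuously.\<close>

lemma pluecker_coords_nonempty:
  fixes F :: "nat \<Rightarrow> (complex ^ 'n) set"
  assumes "F \<in> Fl"
  obtains p where "p \<in> pluecker_coords F"
proof -
  have "\<exists>b. i \<le> CARD('n) \<longrightarrow> vec.span (b ` {..<i}) = F i" for i
  proof (cases "i \<le> CARD('n)")
    case True
    obtain B where B: "B \<subseteq> F i" "vec.independent B" "F i \<subseteq> vec.span B" "card B = vec.dim (F i)"
      by (rule vec.basis_exists)
    have "vec.span B = F i" using B FlD[OF assms True] vec.span_subspace by blast
    moreover obtain b where "b ` {..<i} = B"
      using ex_bij_betw_nat_finite[of B] vec.finiteI_independent[OF B(2)] B(4) FlD(2)[OF assms True]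
      by (auto simp: lessThan_atLeast0 bij_betw_def)
    ultimately show ?thesis by blast
  qed auto
  then obtain b where "\<And>i. i \<le> CARD('n) \<longrightarrow> vec.span (b i ` {..<i}) = F i" by metis
  then show ?thesis using that unfolding pluecker_coords_def by blast
qed

lemma span_pluecker_coords:
  fixes F :: "nat \<Rightarrow> (complex ^ 'n) set"
  assumes "F \<in> Fl" "p \<in> pluecker_coords F" "i \<le> CARD('n)"
  shows "vec.span {pluecker_vec p a s | a s. length a = i \<and> s < i} = F i"
proof -
  obtain b where b: "p = (\<lambda>a. wedge_coord (b (length a)) a)"
    "\<And>i. i \<le> CARD('n) \<Longrightarrow> vec.span (b i ` {..<i}) = F i"
    using assms(2) by (auto simp: pluecker_coords_def)
  have "pluecker_vec p a s = pluecker_vec (wedge_coord (b i)) a s" if "length a = i" for a s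
    using that by (simp add: pluecker_vec_def b(1))
  then have "{pluecker_vec p a s | a s. length a = i \<and> s < i}
    = {pluecker_vec (wedge_coord (b i)) a s | a s. length a = i \<and> s < i}" by metis
  then show ?thesis
    using span_pluecker_vec[of "b i" i] b(2)[OF assms(3)] FlD[OF assms(1,3)] by simp
qed

context eps_form
begin

lemma form_eq_sum:
  "\<beta> v w = (\<Sum>x\<in>UNIV. \<Sum>y\<in>UNIV. v $ x * w $ y * \<beta> (axis x 1) (axis y 1))"
proof -
  have *: "v = (\<Sum>x\<in>UNIV. v $ x *s axis x 1)" for v :: "complex ^ 'n"
    by (simp add: basis_expansion)
  show ?thesis
    by (subst *[of v], subst *[of w]) (simp add: form_sum sum_distrib_left mult_ac, rule sum.swap)
qed

lemma zariski_closed_form_rank: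
  assumes "i \<le> CARD('n)" "j \<le> CARD('n)"
  shows "zariski_closed {F \<in> Fl. form_rank \<beta> (F i) (F j) \<le> r}"
proof -
  \<comment> \<open>Minors of size \<open>Suc r\<close> of the form on the spanning vectors of
    \<open>F i\<close> and \<open>F j\<close> read off from the coordinates
    \<open>p\<close>.\<close>
  define f where "f a s c t = (\<lambda>p. detf (Suc r) (\<lambda>k l. \<beta> (pluecker_vec p (a k) (s k)) (pluecker_vec p (c l) (t l))))"
    for a c :: "nat \<Rightarrow> 'n list" and s t :: "nat \<Rightarrow> nat"
  define S where "S = {f a s c t | a s c t.
    \<forall>k<Suc r. length (a k) = i \<and> s k < i \<and> length (c k) = j \<and> t k < j}"
  have "polynomial_fun (f a s c t)" for a s c t
    unfolding f_def
  proof (rule polynomial_fun_detf)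
    show "polynomial_fun (\<lambda>p. \<beta> (pluecker_vec p a s) (pluecker_vec p c t))" for a s c t
      by (subst form_eq_sum, unfold pluecker_vec_def vec_lambda_beta, intro polynomial_fun_sum polynomial_fun.intros) auto
  qed
  then have "\<forall>f\<in>S. polynomial_fun f" unfolding S_def by blast
  moreover have "{F \<in> Fl. form_rank \<beta> (F i) (F j) \<le> r} = {F \<in> Fl. \<forall>f\<in>S. \<forall>p\<in>pluecker_coords F. f p = 0}"
  proof (intro Collect_cong conj_cong refl)
    fix F :: "nat \<Rightarrow> (complex ^ 'n) set" assume F: "F \<in> Fl"
    have *: "form_rank \<beta> (F i) (F j) \<le> r \<longleftrightarrow> (\<forall>f\<in>S. f p = 0)" if p: "p \<in> pluecker_coords F" for p
    proof -
      let ?V = "\<lambda>i. {pluecker_vec p a s | a s. length a = i \<and> s < i}"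
      have "?V i = (\<lambda>(a, s). pluecker_vec p a s) ` ({a. set a \<subseteq> UNIV \<and> length a = i} \<times> {..<i})"
        by auto
      also have "finite \<dots>"
        by (intro finite_imageI finite_cartesian_product finite_lists_length_eq) auto
      finally have "finite (?V i)" .
      from le_form_rank_iff_minor[OF this, of "Suc r" "?V j"]
      have "\<not> form_rank \<beta> (F i) (F j) \<le> r \<longleftrightarrow>
        (\<exists>v w. (\<forall>k<Suc r. v k \<in> ?V i) \<and> (\<forall>l<Suc r. w l \<in> ?V j) \<and> detf (Suc r) (\<lambda>k l. \<beta> (v k) (w l)) \<noteq> 0)"
        unfolding span_pluecker_coords[OF F p assms(1)] span_pluecker_coords[OF F p assms(2)] Suc_le_eq not_le .
      also have "\<dots> \<longleftrightarrow> (\<exists>f\<in>S. f p \<noteq> 0)"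
      proof
        assume "\<exists>v w. (\<forall>k<Suc r. v k \<in> ?V i) \<and> (\<forall>l<Suc r. w l \<in> ?V j) \<and> detf (Suc r) (\<lambda>k l. \<beta> (v k) (w l)) \<noteq> 0"
        then obtain v w where v: "\<forall>k<Suc r. v k \<in> ?V i" and w: "\<forall>l<Suc r. w l \<in> ?V j"
          and d: "detf (Suc r) (\<lambda>k l. \<beta> (v k) (w l)) \<noteq> 0" by blast
        have "\<forall>k. \<exists>a s. k < Suc r \<longrightarrow> v k = pluecker_vec p a s \<and> length a = i \<and> s < i"
          using v by auto
        then obtain a s where a: "\<And>k. k < Suc r \<Longrightarrow> v k = pluecker_vec p (a k) (s k) \<and> length (a k) = i \<and> s k < i"
          by metis
        have "\<forall>k. \<exists>a s. k < Suc r \<longrightarrow> w k = pluecker_vec p a s \<and> length a = j \<and> s < j"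
          using w by auto
        then obtain c t where c: "\<And>k. k < Suc r \<Longrightarrow> w k = pluecker_vec p (c k) (t k) \<and> length (c k) = j \<and> t k < j"
          by metis
        have "f a s c t p = detf (Suc r) (\<lambda>k l. \<beta> (v k) (w l))"
          unfolding f_def using a c by (intro detf_cong) auto
        moreover have "f a s c t \<in> S" unfolding S_def using a c by blast
        ultimately show "\<exists>f\<in>S. f p \<noteq> 0" using d by metis
      next
        assume "\<exists>f\<in>S. f p \<noteq> 0"
        then obtain a s c t where "f a s c t p \<noteq> 0"
          "\<forall>k<Suc r. length (a k) = i \<and> s k < i \<and> length (c k) = j \<and> t k < j"
          unfolding S_def by blast
        then show "\<exists>v w. (\<forall>k<Suc r. v k \<in> ?V i) \<and> (\<forall>l<Suc r. w l \<in> ?V j) \<and> detf (Suc r) (\<lambda>k l. \<beta> (v k) (w l)) \<noteq> 0"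
          unfolding f_def
          by (intro exI[of _ "\<lambda>k. pluecker_vec p (a k) (s k)"] exI[of _ "\<lambda>l. pluecker_vec p (c l) (t l)"]) auto
      qed
      finally show ?thesis by blast
    qed
    obtain p where "p \<in> pluecker_coords F" by (rule pluecker_coords_nonempty[OF F])
    with * show "form_rank \<beta> (F i) (F j) \<le> r \<longleftrightarrow> (\<forall>f\<in>S. \<forall>p\<in>pluecker_coords F. f p = 0)"
      by blast
  qed
  ultimately show ?thesis unfolding zariski_closed_def by blast
qed

end

section \<open>Limits of flags\<close>

text \<open>Linear maps move all subspaces of \<open>F\<close> at once and carry spanning vectors
  along, so Pluecker coordinates converge one by one. Membership for infinitely many
  \<open>m\<close> suffices, and this form can also refute a failure that keeps recurring.\<close>

lemma zariski_closed_limit: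
  fixes F :: "nat \<Rightarrow> (complex ^ 'n) set"
  assumes "zariski_closed Z" "F \<in> Fl"
    and lin: "\<And>m. Vector_Spaces.linear (*s) (*s) (L m)"
    and lim: "\<And>v. (\<lambda>m. L m v) \<longlonglongrightarrow> v"
    and freq: "\<exists>\<^sub>F m in sequentially. G m \<in> Z"
    and G: "\<And>m i. i \<le> CARD('n) \<Longrightarrow> G m i = L m ` F i"
  shows "F \<in> Z"
proof -
  obtain S where S: "\<forall>f\<in>S. polynomial_fun f" "Z = {F \<in> Fl. \<forall>f\<in>S. \<forall>p\<in>pluecker_coords F. f p = 0}"
    using assms(1) unfolding zariski_closed_def by (elim exE conjE)
  have "f p = 0" if f: "f \<in> S" and p: "p \<in> pluecker_coords F" for f p
  proof -
    obtain b where b: "p = (\<lambda>a. wedge_coord (b (length a)) a)"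
      "\<And>i. i \<le> CARD('n) \<Longrightarrow> vec.span (b i ` {..<i}) = F i"
      using p by (auto simp: pluecker_coords_def)
    define q where "q m = (\<lambda>a. wedge_coord (\<lambda>r. L m (b (length a) r)) a)" for m
    have "q m \<in> pluecker_coords (G m)" for m
    proof -
      have "vec.span ((\<lambda>r. L m (b i r)) ` {..<i}) = G m i" if "i \<le> CARD('n)" for i
        using module_hom.span_image[OF lin[of m, unfolded linear_iff_module_hom], of "b i ` {..<i}"]
          b(2)[OF that] G[OF that] by (simp add: image_image)
      then show ?thesis unfolding pluecker_coords_def q_def
        by (intro CollectI exI[of _ "\<lambda>i r. L m (b i r)"]) auto
    qed
    then have "f (q m) = 0" if "G m \<in> Z" for m
      using that f unfolding S(2) by blast
    with freq have "\<exists>\<^sub>F m in sequentially. f (q m) = 0" by (rule frequently_elim1)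
    moreover have "(\<lambda>m. q m a) \<longlonglongrightarrow> p a" for a
      unfolding q_def b(1) wedge_coord_def by (intro tendsto_sum tendsto_mult tendsto_const tendsto_prod tendsto_vec_nth lim)
    then have "(\<lambda>m. f (q m)) \<longlonglongrightarrow> f p"
      by (rule continuous_polynomial_fun[of f q p, OF bspec[OF S(1) f]])
    ultimately show ?thesis
      using tendsto_imp_eventually_ne[of "\<lambda>m. f (q m)" "f p" sequentially 0] by (auto simp: frequently_def)
  qed
  then show ?thesis using assms(2) by (subst S(2)) blast
qed

section \<open>Involutions and their rank functions\<close>

lemma I_O_D:
  assumes "y \<in> I_O n"
  shows "y permutes {1..n}" "y (y i) = i" "y i \<in> {1..n} \<longleftrightarrow> i \<in> {1..n}"
proof -
  show y: "y permutes {1..n}" using assms by (simp add: I_O_def)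
  show "y (y i) = i" using assms permutes_inverses[OF y] by (auto simp: I_O_def)
  show "y i \<in> {1..n} \<longleftrightarrow> i \<in> {1..n}" using permutes_in_image[OF y] .
qed

lemma rk_Suc_left: "rk y (Suc i) j = rk y i j + (if y (Suc i) \<in> {1..j} then 1 else 0)"
proof -
  have "{t \<in> {1..Suc i}. y t \<in> {1..j}} =
    (if y (Suc i) \<in> {1..j} then insert (Suc i) {t \<in> {1..i}. y t \<in> {1..j}} else {t \<in> {1..i}. y t \<in> {1..j}})"
    by (auto simp: le_Suc_eq)
  then show ?thesis unfolding rk_def by simp
qed

lemma rk_commute:
  assumes "y \<in> I_O n"
  shows "rk y i j = rk y j i"
  unfolding rk_def
  by (rule bij_betw_same_card[of y], rule bij_betw_byWitness[where f' = y])
     (use I_O_D(2)[OF assms] in auto)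

lemma rk_Suc_right:
  assumes "y \<in> I_O n"
  shows "rk y i (Suc j) = rk y i j + (if y (Suc j) \<in> {1..i} then 1 else 0)"
  using rk_Suc_left[of y j i] by (simp add: rk_commute[OF assms])

lemma even_card_fixpoint_free_involution:
  assumes "finite A" "\<And>x. x \<in> A \<Longrightarrow> f x \<in> A \<and> f x \<noteq> x \<and> f (f x) = x"
  shows "even (card A)"
  using assms
proof (induction "card A" arbitrary: A rule: less_induct)
  case less
  show ?case
  proof (cases "A = {}")
    case False
    then obtain x where x: "x \<in> A" by auto
    let ?B = "A - {x, f x}"
    have "card {x, f x} = 2" using less.prems(2)[OF x] by (metis card_2_iff)
    then have c: "card A = card ?B + 2"
      using less.prems(1) less.prems(2)[OF x] x card_Diff_subset[of "{x, f x}" A]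
        card_mono[of A "{x, f x}"] by simp
    have "even (card ?B)"
    proof (rule less.hyps)
      show "f z \<in> ?B \<and> f z \<noteq> z \<and> f (f z) = z" if "z \<in> ?B" for z
        using that less.prems(2)[of z] less.prems(2)[OF x] by auto
    qed (use c less.prems in auto)
    then show ?thesis using c by simp
  qed simp
qed

lemma even_rk_diagonal:
  assumes "y \<in> I_Sp n" "i \<le> n"
  shows "even (rk y i i)"
  unfolding rk_def
proof (rule even_card_fixpoint_free_involution[of _ y])
  have y: "y \<in> I_O n" and fp: "\<And>t. t \<in> {1..n} \<Longrightarrow> y t \<noteq> t"
    using assms(1) by (auto simp: I_Sp_def)
  fix t assume "t \<in> {t \<in> {1..i}. y t \<in> {1..i}}"
  then show "y t \<in> {t \<in> {1..i}. y t \<in> {1..i}} \<and> y t \<noteq> t \<and> y (y t) = t"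
    using I_O_D(2)[OF y] fp[of t] assms(2) by auto
qed simp

section \<open>Essential rank conditions\<close>

text \<open>If \<open>i\<close> exceeded \<open>n\<close>, then \<open>y i = i\<close> and
  \<open>j < i < y j\<close>; but a value beyond \<open>n\<close> is taken only at itself.\<close>

lemma rothe_bounds:
  assumes y: "y \<in> I_O n" and "1 \<le> i" "1 \<le> j" and ij: "j < y i" "i < y j"
  shows "i \<le> n" "j \<le> n"
proof -
  have *: "i \<le> n" if "1 \<le> i" "1 \<le> j" "j < y i" "i < y j" for i j
  proof (rule ccontr)
    assume "\<not> i \<le> n"
    then have "j < i" "n < y j"
      using that permutes_not_in[OF I_O_D(1)[OF y], of i] by auto
    then show False
      using I_O_D(3)[OF y, of j] permutes_not_in[OF I_O_D(1)[OF y], of j] that by auto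
  qed
  show "i \<le> n" "j \<le> n" using *[of i j] *[of j i] assms by auto
qed

text \<open>A violated rank condition of least \<open>i + j\<close> lies in the Rothe diagram (off the diagonal if the
  diagonal ranks are even), and a violated one in the diagram can be moved outwards to the essential set.\<close>

lemma rank_conditions_from_Ess:
  fixes r :: "nat \<Rightarrow> nat \<Rightarrow> nat"
  assumes y: "y \<in> I_O n"
    and D: "D = {(i, j). 1 \<le> i \<and> 1 \<le> j \<and> j < y i \<and> i < y j \<and> j \<le> i \<and> (i = j \<longrightarrow> P)}"
    and sym: "\<And>i j. i \<le> n \<Longrightarrow> j \<le> n \<Longrightarrow> r i j = r j i"
    and zero: "\<And>j. j \<le> n \<Longrightarrow> r 0 j = 0"
    and mono: "\<And>i j. Suc i \<le> n \<Longrightarrow> j \<le> n \<Longrightarrow> r i j \<le> r (Suc i) j"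
    and step: "\<And>i j. Suc i \<le> n \<Longrightarrow> j \<le> n \<Longrightarrow> r (Suc i) j \<le> Suc (r i j)"
    and parity: "\<And>i. \<not> P \<Longrightarrow> i \<le> n \<Longrightarrow> even (r i i) \<and> even (rk y i i)"
    and Ess: "\<And>i j. (i, j) \<in> Ess D \<Longrightarrow> r i j \<le> rk y i j"
    and ij: "i \<le> n" "j \<le> n"
  shows "r i j \<le> rk y i j"
proof (rule ccontr)
  define v where "v i j \<longleftrightarrow> i \<le> n \<and> j \<le> n \<and> rk y i j < r i j" for i j
  have y_range: "1 \<le> y i \<and> y i \<le> n" if "1 \<le> i" "i \<le> n" for i
    using I_O_D(3)[OF y, of i] that by simp
  have y_fix: "y i = i" if "n < i" for i
    using I_O_D(1)[OF y] that by (simp add: permutes_def)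
  have yy: "y (y i) = i" for i by (rule I_O_D(2)[OF y])
  have v_sym: "v i j \<longleftrightarrow> v j i" for i j
    using sym[of i j] rk_commute[OF y, of i j] by (auto simp: v_def)
  assume "\<not> r i j \<le> rk y i j"
  then have "v i j" using ij by (simp add: v_def)
  then obtain a b where ab: "v a b" and least': "\<And>i j. v i j \<Longrightarrow> a + b \<le> i + j"
    using ex_has_least_nat[of "\<lambda>(i, j). v i j" "(i, j)" "\<lambda>(i, j). i + j"] by auto
  define m where "m = a + b"
  have least: "\<And>i j. v i j \<Longrightarrow> m \<le> i + j" using least' by (simp add: m_def)
  have ab: "v a b" "a + b = m" using ab by (simp_all add: m_def)
  \<comment> \<open>Removing row \<open>a\<close> lowers \<open>r\<close> by at most one. If
    \<open>y a \<le> b\<close>, it lowers \<open>rk y\<close> by one as well, and a smaller pair is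
    violated already.\<close>
  have below: "b < y a" "a \<noteq> 0" if ab: "v a b" "a + b = m" for a b
  proof -
    show a0: "a \<noteq> 0" using ab zero[of b] by (auto simp: v_def intro: ccontr)
    then obtain a' where a: "a = Suc a'" by (auto simp: gr0_conv_Suc)
    have a': "a' + b < m" "Suc a' \<le> n" "b \<le> n" using ab a by (auto simp: v_def)
    then have "r a' b \<le> rk y a' b" using least[of a' b] by (fastforce simp: v_def)
    then have "y a \<notin> {1..b}"
      using ab(1) step[of a' b] a' by (auto simp: v_def a rk_Suc_left split: if_splits)
    then show "b < y a" using y_range[of a] a a' by auto
  qed
  \<comment> \<open>Two different even ranks differ by at least two, so a violation on the diagonal
    would survive the removal of a row, against minimality.\<close>
  have diag: "a = b \<longrightarrow> P"
  proof (intro impI, rule ccontr)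
    assume "a = b" "\<not> P"
    obtain a' where a: "a = Suc a'" using below(2)[OF ab] by (auto simp: gr0_conv_Suc)
    have an: "a \<le> n" using ab by (simp add: v_def)
    have "even (r a a)" "even (rk y a a)" using parity[OF \<open>\<not> P\<close> an] by auto
    then have "rk y a a + 2 \<le> r a a" using ab(1) \<open>a = b\<close> by (auto simp: v_def elim!: evenE)
    moreover have "r a a \<le> Suc (r a' a)" using step[of a' a] a an by simp
    moreover have "rk y a' a \<le> rk y a a" by (simp add: a rk_Suc_left)
    ultimately have "v a' a" using a an by (simp add: v_def)
    then show False using least[of a' a] a ab(2) \<open>a = b\<close> by simp
  qed
  have "v b a" "b + a = m" using ab v_sym[of a b] by auto
  then have mem: "(a, b) \<in> D \<or> (b, a) \<in> D"
    using below[OF ab] below[of b a] diag D by auto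
  then obtain a' b' where "v a' b'" "(a', b') \<in> D" using ab \<open>v b a\<close> by blast
  then obtain i j where v: "v i j" and iD: "(i, j) \<in> D"
    and max: "\<And>i' j'. v i' j' \<Longrightarrow> (i', j') \<in> D \<Longrightarrow> i' + j' \<le> i + j"
    using ex_has_greatest_nat[of "\<lambda>(i, j). v i j \<and> (i, j) \<in> D" "(a', b')" "\<lambda>(i, j). i + j" "2 * n + 1"]
    by (auto simp: v_def)
  have D_le: "i \<le> n" "j \<le> n" if "(i, j) \<in> D" for i j
    using rothe_bounds[OF y] that D by auto
  have "(Suc i, j) \<notin> D"
  proof
    assume D': "(Suc i, j) \<in> D"
    \<comment> \<open>Membership in the diagram places the entry of row \<open>Suc i\<close> beyond
      column \<open>j\<close>, so \<open>rk y\<close> does not grow with this row.\<close>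
    have "rk y (Suc i) j = rk y i j" using D' D by (auto simp: rk_Suc_left)
    moreover have "r i j \<le> r (Suc i) j" using mono D_le[OF D'] by auto
    ultimately have "v (Suc i) j" using v D_le[OF D'] by (simp add: v_def)
    from max[OF this D'] show False by simp
  qed
  moreover have "(i, Suc j) \<notin> D"
  proof
    assume D': "(i, Suc j) \<in> D"
    have "rk y i (Suc j) = rk y i j" using D' D by (auto simp: rk_Suc_right[OF y])
    moreover have "r i j \<le> r i (Suc j)" using mono[of j i] sym D_le[OF D'] D_le[OF iD] by auto
    ultimately have "v i (Suc j)" using v D_le[OF D'] by (simp add: v_def)
    from max[OF this D'] show False by simp
  qed
  moreover have "(Suc i, Suc j) \<notin> D"
  proof
    assume D': "(Suc i, Suc j) \<in> D"
    \<comment> \<open>Otherwise \<open>y (Suc i) = j\<close>, contrary to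
      \<open>Suc j < y (Suc i)\<close>. So \<open>i < y j\<close> improves to
      \<open>Suc i < y j\<close>.\<close>
    have "y j \<noteq> Suc i" using D' D yy[of j] by auto
    then have "(Suc i, j) \<in> D" using D' iD D by auto
    then show False using \<open>(Suc i, j) \<notin> D\<close> by simp
  qed
  ultimately have "(i, j) \<in> Ess D" using iD by (simp add: Ess_def)
  from Ess[OF this] v show False by (simp add: v_def)
qed

section \<open>Normal forms of flags\<close>

definition flag_basis :: "(nat \<Rightarrow> complex ^ 'n) \<Rightarrow> (nat \<Rightarrow> (complex ^ 'n) set) \<Rightarrow> bool" where
  "flag_basis e F \<longleftrightarrow> (\<forall>i\<le>CARD('n). F i = vec.span (e ` {1..i}))"

lemma flag_basis_exists:
  fixes F :: "nat \<Rightarrow> (complex ^ 'n) set"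
  assumes F: "F \<in> Fl"
  obtains e where "flag_basis e F"
proof -
  have "\<exists>x. i < CARD('n) \<longrightarrow> x \<in> F (Suc i) - F i" for i
    using F by (auto simp: Fl_def)
  then obtain x where x: "\<And>i. i < CARD('n) \<Longrightarrow> x i \<in> F (Suc i) - F i" by metis
  define e where "e i = x (i - 1)" for i
  have "F i = vec.span (e ` {1..i})" if "i \<le> CARD('n)" for i
    using that
  proof (induction i)
    case 0
    then show ?case using FlD[OF F, of 0] vec.dim_eq_0[of "F 0"] vec.subspace_0[of "F 0"] by auto
  next
    case (Suc i)
    have IH: "F i = vec.span (e ` {1..i})" using Suc by simp
    have img: "e ` {1..Suc i} = insert (e (Suc i)) (e ` {1..i})"
      by (simp add: atLeastAtMostSuc_conv)
    have e: "e (Suc i) \<in> F (Suc i)" "e (Suc i) \<notin> vec.span (e ` {1..i})"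
      using x[of i] Suc.prems IH by (auto simp: e_def)
    have "F i \<subset> F (Suc i)" using F Suc.prems by (auto simp only: Fl_def mem_Collect_eq Suc_le_eq)
    then have "e ` {1..Suc i} \<subseteq> F (Suc i)"
      unfolding img using e(1) IH vec.span_superset by blast
    then have sub: "vec.span (e ` {1..Suc i}) \<subseteq> F (Suc i)"
      using FlD(1)[OF F Suc.prems] by (rule vec.span_minimal)
    have "vec.dim (e ` {1..i}) = i" using FlD(2)[OF F, of i] Suc.prems IH by simp
    then have "vec.dim (vec.span (e ` {1..Suc i})) = Suc i"
      unfolding img using e(2) by (simp add: vec.dim_insert)
    then show ?case
      using vec.subspace_dim_equal[OF vec.subspace_span FlD(1)[OF F Suc.prems] sub] FlD(2)[OF F Suc.prems]
      by simp
  qed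
  then show ?thesis using that by (auto simp: flag_basis_def)
qed

lemma span_insert_add:
  assumes "x \<in> vec.span S"
  shows "vec.span (insert (v + x) S) = vec.span (insert v S)"
proof -
  have "v + x \<in> vec.span (insert v S)"
    using assms vec.span_mono[of S "insert v S"] by (intro vec.span_add) (auto intro: vec.span_base)
  moreover have "(v + x) - x \<in> vec.span (insert (v + x) S)"
    using assms vec.span_mono[of S "insert (v + x) S"] by (intro vec.span_diff) (auto intro: vec.span_base)
  ultimately show ?thesis
    by (intro subset_antisym vec.span_minimal vec.subspace_span) (auto intro: vec.span_base)
qed

lemma flag_basis_triangular:
  fixes F :: "nat \<Rightarrow> (complex ^ 'n) set"
  assumes "flag_basis e F" "\<And>i. i \<in> {1..CARD('n)} \<Longrightarrow> e' i - e i \<in> vec.span (e ` {1..<i})"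
  shows "flag_basis e' F"
proof -
  have "vec.span (e' ` {1..i}) = vec.span (e ` {1..i})" if "i \<le> CARD('n)" for i
    using that
  proof (induction i)
    case (Suc i)
    have IH: "vec.span (e' ` {1..i}) = vec.span (e ` {1..i})" using Suc by simp
    have img: "f ` {1..Suc i} = insert (f (Suc i)) (f ` {1..i})" for f :: "nat \<Rightarrow> complex ^ 'n"
      by (simp add: atLeastAtMostSuc_conv)
    have "vec.span (e' ` {1..Suc i}) = vec.span (insert (e' (Suc i)) (e ` {1..i}))"
      unfolding img vec.span_insert IH ..
    also have "\<dots> = vec.span (insert (e (Suc i) + (e' (Suc i) - e (Suc i))) (e ` {1..i}))"
      by simp
    also have "\<dots> = vec.span (e ` {1..Suc i})"
      unfolding img using assms(2)[of "Suc i"] Suc.prems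
      by (intro span_insert_add) (simp add: atLeastLessThanSuc_atLeastAtMost)
    finally show ?case .
  qed simp
  then show ?thesis using assms(1) by (simp add: flag_basis_def)
qed

lemma flag_basis_nonzero:
  fixes F :: "nat \<Rightarrow> (complex ^ 'n) set"
  assumes "F \<in> Fl" "flag_basis e F" "a \<in> {1..CARD('n)}"
  shows "e a \<noteq> 0"
proof
  assume "e a = 0"
  obtain b where a: "a = Suc b" using assms(3) by (cases a) auto
  have "F a = F b"
    using assms(2,3) \<open>e a = 0\<close>
    by (simp add: flag_basis_def a atLeastAtMostSuc_conv)
  then show False using FlD(2)[OF assms(1), of a] FlD(2)[OF assms(1), of b] assms(3) a by simp
qed

lemma flag_basis_UNIV:
  fixes F :: "nat \<Rightarrow> (complex ^ 'n) set"
  assumes "F \<in> Fl" "flag_basis e F"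
  shows "vec.span (e ` {1..CARD('n)}) = UNIV"
proof -
  have "vec.dim (F CARD('n)) = vec.dim (UNIV :: (complex ^ 'n) set)"
    using FlD(2)[OF assms(1)] by (simp only: vec_dim_card order_refl)
  then have "F CARD('n) = UNIV"
    using vec.subspace_dim_equal[of "F CARD('n)" UNIV] FlD(1)[OF assms(1), of "CARD('n)"] by simp
  then show ?thesis using assms(2) by (simp add: flag_basis_def)
qed

section \<open>A Gram-Schmidt process adapted to a flag\<close>

context eps_form
begin

text \<open>The invariant of the process: the rows of the Gram matrix indexed by \<open>T\<close>
  have their final monomial shape.\<close>

definition partial_normal where
  "partial_normal F T e z \<longleftrightarrow> T \<subseteq> {1..CARD('n)} \<and> flag_basis e F \<and> (\<forall>t\<in>T. z t \<in> T \<and> z (z t) = t) \<and>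
     (\<forall>t\<in>T. \<forall>j\<in>{1..CARD('n)}. \<beta> (e t) (e j) \<noteq> 0 \<longleftrightarrow> j = z t)"

text \<open>The least free index \<open>a\<close> is matched with the least \<open>k\<close> such
  that \<open>e a\<close> pairs with \<open>e k\<close>; nondegeneracy provides one. Both minima are
  taken so that the corrections add only multiples of earlier basis vectors and hence preserve the
  flag. If \<open>k = a\<close>, the line of \<open>e a\<close> is split off orthogonally, otherwise
  the plane of \<open>e a\<close> and \<open>e k\<close>.\<close>

lemma partial_normal_extend:
  assumes F: "F \<in> Fl" and pn: "partial_normal F T e z" and T: "T \<noteq> {1..CARD('n)}"
  shows "\<exists>T' e' z'. partial_normal F T' e' z' \<and> T \<subset> T'"
proof -
  let ?n = "CARD('n)"
  have e: "flag_basis e F" and TN: "T \<subseteq> {1..?n}"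
    and z: "\<And>t. t \<in> T \<Longrightarrow> z t \<in> T" "\<And>t. t \<in> T \<Longrightarrow> z (z t) = t"
    and mon: "\<And>t j. t \<in> T \<Longrightarrow> j \<in> {1..?n} \<Longrightarrow> \<beta> (e t) (e j) \<noteq> 0 \<longleftrightarrow> j = z t"
    using pn unfolding partial_normal_def by blast+
  define a where "a = Min ({1..?n} - T)"
  have ne: "{1..?n} - T \<noteq> {}" using T TN by auto
  have a: "a \<in> {1..?n}" "a \<notin> T" using Min_in[OF _ ne] by (auto simp: a_def)
  have a_least: "a \<le> j" if "j \<in> {1..?n}" "j \<notin> T" for j
    using that by (auto simp: a_def)
  have mon0: "\<beta> (e t) (e j) = 0" "\<beta> (e j) (e t) = 0" if "t \<in> T" "j \<in> {1..?n}" "j \<notin> T" for t j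
    using mon[of t j] z(1)[of t] that form_zero_sym by auto
  have "\<exists>j. j \<in> {1..?n} \<and> \<beta> (e a) (e j) \<noteq> 0"
  proof (rule ccontr)
    assume "\<nexists>j. j \<in> {1..?n} \<and> \<beta> (e a) (e j) \<noteq> 0"
    then have "\<beta> (e a) w = 0" for w
      using form_zero_span[of "e ` {1..?n}" "e a" w] flag_basis_UNIV[OF F e] by blast
    then have "e a = 0" using nondeg by (auto simp: nondegenerate_def)
    then show False using flag_basis_nonzero[OF F e a(1)] by simp
  qed
  then obtain k where k: "k \<in> {1..?n}" "\<beta> (e a) (e k) \<noteq> 0"
    and k_least: "\<And>j. j \<in> {1..?n} \<Longrightarrow> \<beta> (e a) (e j) \<noteq> 0 \<Longrightarrow> k \<le> j"
    using ex_has_least_nat[of "\<lambda>j. j \<in> {1..?n} \<and> \<beta> (e a) (e j) \<noteq> 0" _ "\<lambda>j. j"] by blast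
  have kT: "k \<notin> T" using mon0(2)[of k a] a k by auto
  define c where "c = \<beta> (e a) (e k)"
  have c: "c \<noteq> 0" "\<beta> (e k) (e a) = \<epsilon> * c" using k(2) eps_sym[of "e k" "e a"] by (auto simp: c_def)
  have eps0: "\<epsilon> \<noteq> 0" using eps by auto
  have base: "e i \<in> vec.span (e ` {1..<j})" if "i \<in> {1..?n}" "i < j" for i j
    using that by (intro vec.span_base) auto
  show ?thesis
  proof (cases "k = a")
    case True
    define e' where "e' j = (if j \<in> insert a T then e j else e j - (\<beta> (e a) (e j) / c) *s e a)" for j
    have "flag_basis e' F"
    proof (rule flag_basis_triangular[OF e])
      fix j assume j: "j \<in> {1..?n}"
      show "e' j - e j \<in> vec.span (e ` {1..<j})"
      proof (cases "j \<in> insert a T")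
        case False
        then have "e' j - e j = (- (\<beta> (e a) (e j) / c)) *s e a" by (simp add: e'_def)
        moreover have "a < j" using False j a_least[of j] by auto
        ultimately show ?thesis using base a by (auto intro: vec.span_scale vec.span_neg)
      qed (simp add: e'_def vec.span_zero)
    qed
    moreover have "\<beta> (e' t) (e' j) \<noteq> 0 \<longleftrightarrow> j = (z(a := a)) t"
      if "t \<in> insert a T" "j \<in> {1..?n}" for t j
      using that a c mon mon0 z unfolding e'_def by (auto simp: c_def True)
    ultimately have "partial_normal F (insert a T) e' (z(a := a))"
      unfolding partial_normal_def using TN a z by auto
    then show ?thesis using a(2) by blast
  next
    case False
    have ak: "a < k" using a_least[OF k(1) kT] False by simp
    have aj: "\<beta> (e a) (e j) = 0" if "j \<in> {1..?n}" "j < k" for j using k_least[of j] that by fastforce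
    \<comment> \<open>The factor 2 makes \<open>u\<close> isotropic in the symmetric case; in the
      skew case \<open>u\<close> is just \<open>e k\<close>.\<close>
    define u where "u = e k - (\<beta> (e k) (e k) / (2 * c)) *s e a"
    have aa: "\<beta> (e a) (e a) = 0" using aj[of a] a ak by simp
    have au: "\<beta> (e a) u = c" by (simp add: u_def aa c_def)
    have ua: "\<beta> u (e a) = \<epsilon> * c" using eps_sym[of u "e a"] au by simp
    have uu: "\<beta> u u = 0"
    proof -
      have "\<beta> u u = \<beta> (e k) (e k) - \<beta> (e k) (e k) / (2 * c) * (c + \<epsilon> * c)"
        using c by (simp add: u_def aa c_def[symmetric] field_simps)
      also have "\<dots> = 0"
        using eps eps_sym[of "e k" "e k"] c(1) by (auto simp: field_simps)
      finally show ?thesis .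
    qed
    \<comment> \<open>Both \<open>e a\<close> and \<open>u\<close> are isotropic, so the coefficient
      along each of them is read off by pairing with the other.\<close>
    define e' where "e' j = (if j = k then u else if j \<in> insert a T then e j
      else e j - (\<beta> (e a) (e j) / c) *s u - (\<beta> u (e j) / (\<epsilon> * c)) *s e a)" for j
    have e'_simps: "e' k = u" "e' a = e a" "\<And>t. t \<in> T \<Longrightarrow> e' t = e t"
      "\<And>j. j \<notin> T \<Longrightarrow> j \<noteq> a \<Longrightarrow> j \<noteq> k \<Longrightarrow>
        e' j = e j - (\<beta> (e a) (e j) / c) *s u - (\<beta> u (e j) / (\<epsilon> * c)) *s e a"
      using False kT by (auto simp: e'_def)
    have "flag_basis e' F"
    proof (rule flag_basis_triangular[OF e])
      fix j assume j: "j \<in> {1..?n}"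
      consider "j = k" | "j \<in> insert a T" "j \<noteq> k" | "j \<notin> T" "j \<noteq> a" "j \<noteq> k" by blast
      then show "e' j - e j \<in> vec.span (e ` {1..<j})"
      proof cases
        case 1
        then show ?thesis using base[OF a(1), of k] ak by (auto simp: e'_simps u_def intro: vec.span_scale vec.span_neg)
      next
        case 2
        then show ?thesis by (auto simp: e'_simps vec.span_zero)
      next
        case 3
        then have "a < j" using a_least[of j] j by auto
        then have ea: "e a \<in> vec.span (e ` {1..<j})" using base a by blast
        \<comment> \<open>For \<open>j < k\<close> a multiple of \<open>u\<close> would break
          triangularity, but minimality of \<open>k\<close> makes the coefficient zero.\<close>
        moreover have "(\<beta> (e a) (e j) / c) *s u \<in> vec.span (e ` {1..<j})"
        proof (cases "j < k")
          case True
          then show ?thesis using aj[OF j] by (simp add: vec.span_zero)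
        next
          case False
          then show ?thesis unfolding u_def
            using base[OF k(1), of j] ea 3 by (intro vec.span_scale vec.span_diff) auto
        qed
        moreover have "e' j - e j = - ((\<beta> (e a) (e j) / c) *s u + (\<beta> u (e j) / (\<epsilon> * c)) *s e a)"
          using 3 by (simp add: e'_simps)
        ultimately show ?thesis by (simp only: vec.span_neg vec.span_add vec.span_scale)
      qed
    qed
    moreover have "\<beta> (e' t) (e' j) \<noteq> 0 \<longleftrightarrow> j = (z(a := k, k := a)) t"
      if t: "t \<in> insert a (insert k T)" and j: "j \<in> {1..?n}" for t j
    proof -
      have tu: "\<beta> (e t) u = 0" "\<beta> u (e t) = 0" "\<beta> (e t) (e a) = 0" "\<beta> (e a) (e t) = 0" if "t \<in> T" for t
        using mon0[OF that a] mon0[OF that k(1) kT] by (simp_all add: u_def)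
      consider "j = k" | "j = a" | "j \<in> T" "j \<noteq> a" "j \<noteq> k" | "j \<notin> T" "j \<noteq> a" "j \<noteq> k" by blast
      note jcases = this
      from t consider "t = a" | "t = k" | "t \<in> T" "t \<noteq> a" "t \<noteq> k" using a kT by blast
      then show ?thesis
      proof cases
        case 1
        from jcases show ?thesis
          by cases (use 1 False a kT c eps0 in \<open>auto simp: e'_simps au aa tu\<close>)
      next
        case 2
        from jcases show ?thesis
          by cases (use 2 False a kT c eps0 in \<open>auto simp: e'_simps au aa tu uu ua\<close>)
      next
        case 3
        have zt: "z t \<in> T" using z 3 by simp
        from jcases show ?thesis
          by cases (use 3 False a kT c eps0 zt mon[OF 3(1) j] in \<open>auto simp: e'_simps tu\<close>)
      qed
    qed
    ultimately have "partial_normal F (insert a (insert k T)) e' (z(a := k, k := a))"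
      unfolding partial_normal_def using TN a k kT z False by auto
    then show ?thesis using a(2) by blast
  qed
qed

text \<open>Only the zero pattern of the Gram matrix is recorded, which is all that the ranks depend
  on.\<close>

definition normal_basis where
  "normal_basis e z F \<longleftrightarrow> flag_basis e F \<and> z \<in> I_O CARD('n) \<and>
     (\<forall>i\<in>{1..CARD('n)}. \<forall>j\<in>{1..CARD('n)}. \<beta> (e i) (e j) \<noteq> 0 \<longleftrightarrow> j = z i)"

lemma normal_basis_exists:
  assumes F: "F \<in> Fl"
  obtains e z where "normal_basis e z F"
proof -
  let ?n = "CARD('n)"
  have "\<exists>e z. partial_normal F {1..?n} e z" if "partial_normal F T e z" for T e z
    using that
  proof (induction "card ({1..?n} - T)" arbitrary: T e z rule: less_induct)
    case less
    show ?case
    proof (cases "T = {1..?n}")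
      case False
      from partial_normal_extend[OF F less.prems this] obtain T' e' z'
        where T': "partial_normal F T' e' z'" "T \<subset> T'" by blast
      have "T' \<subseteq> {1..?n}" using T'(1) by (simp add: partial_normal_def)
      then have "card ({1..?n} - T') < card ({1..?n} - T)"
        using T'(2) by (intro psubset_card_mono) auto
      from less.hyps[OF this T'(1)] show ?thesis .
    qed (use less.prems in auto)
  qed
  moreover obtain e where "flag_basis e F" by (rule flag_basis_exists[OF F])
  then have "partial_normal F {} e id" by (simp add: partial_normal_def)
  ultimately obtain e z where pn: "partial_normal F {1..?n} e z" by blast
  \<comment> \<open>The process controls \<open>z\<close> on the index range only; elsewhere the
    identity is used to obtain a permutation.\<close>
  define y where "y i = (if i \<in> {1..?n} then z i else i)" for i
  have z: "\<And>t. t \<in> {1..?n} \<Longrightarrow> z t \<in> {1..?n} \<and> z (z t) = t"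
    using pn unfolding partial_normal_def by blast
  have yy: "y (y i) = i" for i using z[of i] by (auto simp: y_def)
  have "y permutes {1..?n}"
    unfolding permutes_def using yy by (metis y_def)
  moreover have "inv_into UNIV y = y"
    by (rule inv_unique_comp) (auto simp: fun_eq_iff yy)
  ultimately have "y \<in> I_O ?n" by (simp add: I_O_def)
  then have "normal_basis e y F"
    using pn unfolding normal_basis_def partial_normal_def y_def by auto
  then show ?thesis by (rule that)
qed

lemma normal_basisD:
  assumes "normal_basis e z F"
  shows "z \<in> I_O CARD('n)" "i \<le> CARD('n) \<Longrightarrow> F i = vec.span (e ` {1..i})"
    "i \<in> {1..CARD('n)} \<Longrightarrow> j \<in> {1..CARD('n)} \<Longrightarrow> \<beta> (e i) (e j) \<noteq> 0 \<longleftrightarrow> j = z i"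
  using assms by (auto simp: normal_basis_def flag_basis_def)

text \<open>The rows \<open>t\<close> with \<open>z t \<le> j\<close> cover all nonzero entries, and
  together with the columns \<open>z t\<close> they form a diagonal block.\<close>

lemma form_rank_normal_basis:
  assumes nb: "normal_basis e z F" and ij: "i \<le> CARD('n)" "j \<le> CARD('n)"
  shows "form_rank \<beta> (F i) (F j) = rk z i j"
proof (rule antisym)
  let ?X = "{t \<in> {1..i}. z t \<in> {1..j}}"
  show "form_rank \<beta> (F i) (F j) \<le> rk z i j"
    using form_rank_cover[of "{1..i}" "{1..j}" ?X "{}" e e] normal_basisD(3)[OF nb] ij
    by (force simp: normal_basisD(2)[OF nb] rk_def)
  show "rk z i j \<le> form_rank \<beta> (F i) (F j)"
    unfolding rk_def normal_basisD(2)[OF nb ij(1)] normal_basisD(2)[OF nb ij(2)]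
  proof (rule card_le_form_rank[where v = e and w = "\<lambda>x. e (z x)"])
    fix x y assume xy: "x \<in> ?X" "y \<in> ?X"
    then have "\<beta> (e x) (e (z y)) \<noteq> 0 \<longleftrightarrow> z y = z x"
      using ij by (intro normal_basisD(3)[OF nb]) auto
    also have "\<dots> \<longleftrightarrow> x = y" using I_O_D(2)[OF normal_basisD(1)[OF nb]] by metis
    finally show "\<beta> (e x) (e (z y)) \<noteq> 0 \<longleftrightarrow> x = y" .
  qed (auto intro!: vec.span_base vec.subspace_span)
qed

lemma normal_basis_FPF:
  assumes nb: "normal_basis e z F" and "\<epsilon> = -1"
  shows "z \<in> I_Sp CARD('n)"
proof -
  have "\<beta> v v = 0" for v using eps_sym[of v v] assms(2) by simp
  then show ?thesis using normal_basisD(1,3)[OF nb] by (auto simp: I_Sp_def) metis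
qed

end

section \<open>Comparison of two involutions\<close>

text \<open>The permutation matrix is cut into four blocks at \<open>m\<close>; by symmetry the
  lower left block is counted through the rows up to \<open>m\<close>.\<close>

lemma rk_split:
  assumes x: "x \<in> I_O n" and "m \<le> i" "m \<le> j"
  shows "rk x i j = rk x m m + card {t \<in> {1..m}. x t \<in> {m<..j}} + card {t \<in> {1..m}. x t \<in> {m<..i}}
    + card {t \<in> {m<..i}. x t \<in> {m<..j}}"
proof -
  let ?A = "{t \<in> {1..m}. x t \<in> {1..m}}" and ?B = "{t \<in> {1..m}. x t \<in> {m<..j}}"
  let ?C = "{t \<in> {m<..i}. x t \<in> {1..m}}" and ?D = "{t \<in> {m<..i}. x t \<in> {m<..j}}"
  have "{t \<in> {1..i}. x t \<in> {1..j}} = (?A \<union> ?B) \<union> (?C \<union> ?D)"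
    using assms by auto
  then have "rk x i j = card ((?A \<union> ?B) \<union> (?C \<union> ?D))" by (simp add: rk_def)
  also have "\<dots> = card ?A + card ?B + (card ?C + card ?D)"
    by (subst card_Un_disjoint; (subst card_Un_disjoint)?; (subst card_Un_disjoint)?) auto
  also have "card ?C = card {t \<in> {1..m}. x t \<in> {m<..i}}"
    by (rule bij_betw_same_card[of x], rule bij_betw_byWitness[where f' = x])
       (use I_O_D(2)[OF x] in auto)
  finally show ?thesis by (simp add: rk_def)
qed

text \<open>The first row \<open>a\<close> in which the permutation matrices of \<open>z\<close> and \<open>y\<close> differ, and the next row \<open>b\<close>
  of \<open>z\<close> with an entry to the left of column \<open>z a\<close>, but not to the left of column \<open>y a\<close>.\<close>

locale involution_gap =
  fixes n :: nat and y z :: "nat \<Rightarrow> nat" and a b :: nat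
  assumes y: "y \<in> I_O n" and z: "z \<in> I_O n"
    and rk_le: "\<And>i j. i \<le> n \<Longrightarrow> j \<le> n \<Longrightarrow> rk z i j \<le> rk y i j"
    and agree: "\<And>t. t < a \<Longrightarrow> z t = y t"
    and less: "y a < z a"
    and ab: "a < b" and zb: "y a \<le> z b" "z b < z a"
    and b_least: "\<And>t. a < t \<Longrightarrow> y a \<le> z t \<Longrightarrow> z t < z a \<Longrightarrow> b \<le> t"
begin

lemmas yy = I_O_D(2)[OF y] and zz = I_O_D(2)[OF z]

lemma z_eq_iff: "z s = t \<longleftrightarrow> s = z t"
  using zz by metis

lemma a_bounds: "1 \<le> a" "a \<le> n" "1 \<le> y a" "z a \<le> n"
proof -
  have "a \<in> {1..n}"
    using permutes_not_in[OF I_O_D(1)[OF y], of a] permutes_not_in[OF I_O_D(1)[OF z], of a] less by force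
  then show "1 \<le> a" "a \<le> n" "1 \<le> y a" "z a \<le> n"
    using I_O_D(3)[OF y, of a] I_O_D(3)[OF z, of a] by auto
qed

text \<open>If \<open>y a < a\<close>, the involutions agree at \<open>y a\<close>, so
  \<open>z\<close> also exchanges \<open>y a\<close> and \<open>a\<close>, against
  \<open>y a < z a\<close>.\<close>

lemma a_le: "a \<le> y a"
proof (rule ccontr)
  assume "\<not> a \<le> y a"
  then have "z (y a) = a" using agree[of "y a"] yy by simp
  then show False using z_eq_iff[of "y a" a] less by simp
qed

lemma b_le: "b \<le> n"
proof -
  have "z b \<in> {1..n}" using zb a_bounds by auto
  then show ?thesis using I_O_D(3)[OF z, of b] by simp
qed

text \<open>In rows up to \<open>i\<close> and columns from \<open>y a\<close> to \<open>j\<close>,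
  all entries of \<open>z\<close> lie in rows before \<open>a\<close>, by the choice of
  \<open>b\<close>. They are shared with \<open>y\<close>, which has the entry of row
  \<open>a\<close> in addition. The columns before \<open>y a\<close> are compared by
  \<open>rk_le\<close>.\<close>

lemma gap_rows:
  assumes i: "a \<le> i" "i < b" and j: "y a \<le> j" "j < z a"
  shows "rk z i j < rk y i j"
proof -
  define m where "m = y a - 1"
  have m: "y a = Suc m" using a_bounds by (simp add: m_def)
  let ?P = "{t \<in> {1..<a}. y t \<in> {m<..j}}"
  have "{t \<in> {1..i}. z t \<in> {1..j}} \<subseteq> ?P \<union> {t \<in> {1..i}. z t \<in> {1..m}}"
  proof
    fix t assume t: "t \<in> {t \<in> {1..i}. z t \<in> {1..j}}"
    consider "t < a" | "t = a" | "a < t" by linarith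
    then show "t \<in> ?P \<union> {t \<in> {1..i}. z t \<in> {1..m}}"
    proof cases
      case 1
      then show ?thesis using t agree[of t] by auto
    next
      case 2
      then show ?thesis using t j by auto
    next
      case 3
      then have "z t \<le> m" using t i j b_least[of t] m by fastforce
      then show ?thesis using t by auto
    qed
  qed
  then have "rk z i j \<le> card (?P \<union> {t \<in> {1..i}. z t \<in> {1..m}})"
    unfolding rk_def by (intro card_mono) auto
  also have "\<dots> \<le> card ?P + rk z i m"
    unfolding rk_def by (rule card_Un_le)
  also have "\<dots> \<le> card ?P + rk y i m"
    using rk_le[of i m] i b_le j a_bounds m by simp
  also have "\<dots> < card (insert a ?P) + card {t \<in> {1..i}. y t \<in> {1..m}}"
    by (simp add: rk_def)
  also have "\<dots> = card (insert a ?P \<union> {t \<in> {1..i}. y t \<in> {1..m}})"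
    using m by (intro card_Un_disjoint[symmetric]) auto
  also have "\<dots> \<le> rk y i j"
    unfolding rk_def using i j m a_bounds by (intro card_mono) auto
  finally show ?thesis .
qed

text \<open>In \<open>rk_split\<close> at \<open>y a - 1\<close>, the entry of \<open>y\<close> in
  row \<open>a\<close> and its mirror image each give one spare rank, one in each off-diagonal
  block. Only entries of \<open>z\<close> in the last block can use them up.\<close>

lemma gap_above:
  assumes "a < y a" "y a \<le> b" and i: "y a \<le> i" "i < z a" and j: "y a \<le> j" "j < z a"
  shows "rk z i j + 2 \<le> rk y i j + card {t \<in> {y a..i}. z t \<in> {y a..j}}"
proof -
  define m where "m = y a - 1"
  have m: "y a = Suc m" using a_bounds by (simp add: m_def)
  have Q: "{y a..k} = {m<..k}" for k using m by auto
  let ?P = "\<lambda>j. {t \<in> {1..<a}. y t \<in> {m<..j}}"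
  have "card {t \<in> {1..m}. z t \<in> {m<..j}} + 1 \<le> card {t \<in> {1..m}. y t \<in> {m<..j}}"
    if j: "y a \<le> j" "j < z a" for j
  proof -
    have "{t \<in> {1..m}. z t \<in> {m<..j}} \<subseteq> ?P j"
    proof
      fix t assume t: "t \<in> {t \<in> {1..m}. z t \<in> {m<..j}}"
      consider "t < a" | "t = a" | "a < t" by linarith
      then show "t \<in> ?P j"
      proof cases
        case 1
        then show ?thesis using t agree[of t] by auto
      next
        case 2
        then show ?thesis using t j by auto
      next
        case 3
        then have "b \<le> t" using t j b_least[of t] m by auto
        then show ?thesis using t assms(2) m by auto
      qed
    qed
    then have "card {t \<in> {1..m}. z t \<in> {m<..j}} + 1 \<le> card (insert a (?P j))"
      by (simp add: card_mono)
    also have "\<dots> \<le> card {t \<in> {1..m}. y t \<in> {m<..j}}"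
      using assms(1) m j a_bounds by (intro card_mono) auto
    finally show ?thesis .
  qed
  from this[OF i] this[OF j] rk_split[OF y, of m i j] rk_split[OF z, of m i j] rk_le[of m m]
  show ?thesis unfolding Q using m i j a_bounds by simp
qed

lemma gap_square:
  assumes "a < y a" and i: "y a \<le> i" "i < z a" "i < b" and j: "y a \<le> j" "j < z a"
  shows "rk z i j + 2 \<le> rk y i j"
proof -
  have *: "{t \<in> {y a..i}. z t \<in> {y a..j}} = {}"
  proof (intro equals0I)
    fix t assume "t \<in> {t \<in> {y a..i}. z t \<in> {y a..j}}"
    then show False using b_least[of t] assms by auto
  qed
  show ?thesis using gap_above[of i j, unfolded *] assms by simp
qed

text \<open>\<open>d\<close> is a lower bound for the rows after \<open>b\<close> with an entry from
  column \<open>b\<close> to column \<open>z a - 1\<close>. Before it, the last block of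
  \<open>z\<close> contains at most the fixed point \<open>b\<close>, which uses up one of the two
  spare ranks of \<open>gap_above\<close>.\<close>

lemma gap_fixpoint:
  assumes "a < y a" "z b = b" and i: "b \<le> i" "i < z a" and j: "b \<le> j" "j < d"
    and d: "\<And>t. b < t \<Longrightarrow> b \<le> z t \<Longrightarrow> z t < z a \<Longrightarrow> d \<le> t" "d \<le> z a"
  shows "rk z i j < rk y i j"
proof -
  have "{t \<in> {y a..i}. z t \<in> {y a..j}} \<subseteq> {b}"
  proof
    fix t assume t: "t \<in> {t \<in> {y a..i}. z t \<in> {y a..j}}"
    have bz: "b \<le> z t" using b_least[of "z t"] t i assms(1) zz[of t] by auto
    moreover have "b \<le> t" using b_least[of t] t i j d assms(1) by auto
    ultimately have "z t = b" using d(1)[of "z t"] t i j zz[of t] by force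
    then show "t \<in> {b}" using assms(2) zz[of t] by simp
  qed
  then have "card {t \<in> {y a..i}. z t \<in> {y a..j}} \<le> card {b}"
    by (intro card_mono) auto
  moreover have "y a \<le> b" using zb assms(2) by simp
  ultimately show ?thesis using gap_above[of i j] assms by simp
qed

end

lemma involution_gap_exists:
  assumes y: "y \<in> I_O n" and z: "z \<in> I_O n" and "z \<noteq> y"
    and rk_le: "\<And>i j. i \<le> n \<Longrightarrow> j \<le> n \<Longrightarrow> rk z i j \<le> rk y i j"
  obtains a b where "involution_gap n y z a b"
proof -
  define a where "a = (LEAST t. z t \<noteq> y t)"
  have "\<exists>t. z t \<noteq> y t" using assms(3) by auto
  then have a: "z a \<noteq> y a" unfolding a_def by (rule LeastI_ex)
  have agree: "z t = y t" if "t < a" for t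
    using not_less_Least[of t "\<lambda>t. z t \<noteq> y t"] that by (auto simp: a_def)
  have an: "a \<in> {1..n}"
    using permutes_not_in[OF I_O_D(1)[OF y]] permutes_not_in[OF I_O_D(1)[OF z]] a by metis
  then obtain a' where a': "a = Suc a'" by (cases a) auto
  \<comment> \<open>If \<open>z a\<close> were smaller, \<open>z\<close> would have one more entry
    than \<open>y\<close> in rows up to \<open>a\<close> and columns up to
    \<open>z a\<close>.\<close>
  have less: "y a < z a"
  proof (rule ccontr)
    assume "\<not> y a < z a"
    then have lt: "z a < y a" using a by simp
    have za: "z a \<in> {1..n}" using an I_O_D(3)[OF z, of a] by blast
    have "rk z a' (z a) = rk y a' (z a)"
      unfolding rk_def by (rule arg_cong[of _ _ card]) (use agree a' in auto)
    then have "rk y a (z a) < rk z a (z a)"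
      using lt za by (simp add: a' rk_Suc_left)
    then show False using rk_le[of a "z a"] an za by simp
  qed
  have zz: "z (z t) = t" for t by (rule I_O_D(2)[OF z])
  \<comment> \<open>The row \<open>z (y a)\<close> is a candidate for \<open>b\<close>: its entry is
    in column \<open>y a\<close>, and it comes after \<open>a\<close> since \<open>y\<close> and
    \<open>z\<close> agree before \<open>a\<close>.\<close>
  have ex: "a < z (y a) \<and> y a \<le> z (z (y a)) \<and> z (z (y a)) < z a"
  proof -
    have "z (y a) \<noteq> a" using zz[of "y a"] a by auto
    moreover have "\<not> z (y a) < a"
    proof
      assume "z (y a) < a"
      then have "y (z (y a)) = y a" using agree[of "z (y a)"] zz by simp
      then have "z (y a) = a" using I_O_D(2)[OF y] by metis
      then show False using \<open>z (y a) < a\<close> by simp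
    qed
    ultimately show ?thesis using zz less by simp
  qed
  define b where "b = (LEAST t. a < t \<and> y a \<le> z t \<and> z t < z a)"
  have b: "a < b \<and> y a \<le> z b \<and> z b < z a" unfolding b_def using ex by (rule LeastI)
  have "b \<le> t" if "a < t" "y a \<le> z t" "z t < z a" for t
    unfolding b_def using that by (intro Least_le) simp
  then have "involution_gap n y z a b"
    using y z rk_le agree less b by unfold_locales auto
  then show ?thesis by (rule that)
qed

section \<open>Degenerations of flags\<close>

locale flag_move = eps_form \<beta> \<epsilon> + involution_gap "CARD('n)" y z a b
  for \<beta> :: "complex ^ 'n \<Rightarrow> complex ^ 'n \<Rightarrow> complex" and \<epsilon> y z a b +
  fixes F :: "nat \<Rightarrow> (complex ^ 'n) set" and e :: "nat \<Rightarrow> complex ^ 'n"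
  assumes F: "F \<in> Fl" and nb: "normal_basis e z F"
begin

abbreviation "p \<equiv> z a"

lemma gram: "i \<in> {1..CARD('n)} \<Longrightarrow> j \<in> {1..CARD('n)} \<Longrightarrow> \<beta> (e i) (e j) \<noteq> 0 \<longleftrightarrow> j = z i"
  using normal_basisD(3)[OF nb] .

lemma gram0: "i \<in> {1..CARD('n)} \<Longrightarrow> j \<in> {1..CARD('n)} \<Longrightarrow> j \<noteq> z i \<Longrightarrow> \<beta> (e i) (e j) = 0"
  using gram by blast

lemma idx: "a \<in> {1..CARD('n)}" "b \<in> {1..CARD('n)}" "p \<in> {1..CARD('n)}" "z b \<in> {1..CARD('n)}"
  "z p = a" "z (z b) = b" "a < p" "a \<le> z b"
  using a_bounds b_le ab zb a_le less zz by auto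

section \<open>Replacing one basis vector\<close>

definition moved :: "complex ^ 'n \<Rightarrow> nat \<Rightarrow> complex ^ 'n" where
  "moved x = e(a := e a + x)"

definition moved_flag :: "complex ^ 'n \<Rightarrow> nat \<Rightarrow> (complex ^ 'n) set" where
  "moved_flag x i = vec.span (moved x ` {1..i})"

lemma moved_simps: "moved x a = e a + x" "t \<noteq> a \<Longrightarrow> moved x t = e t"
  by (auto simp: moved_def)

lemma moved_flag_below: "i < a \<Longrightarrow> moved_flag x i = vec.span (e ` {1..i})"
  unfolding moved_flag_def by (rule arg_cong[of _ _ vec.span]) (auto simp: moved_def)

text \<open>From index \<open>h\<close> on, \<open>x\<close> lies in the span of the other basis
  vectors. So only the subspaces with index from \<open>a\<close> to \<open>h - 1\<close> can
  change.\<close>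

lemma moved_flag_above:
  assumes x: "x \<in> vec.span (e ` {a<..h})" and "a < h" "h \<le> i"
  shows "moved_flag x i = vec.span (e ` {1..i})"
proof -
  let ?S = "e ` ({1..i} - {a})"
  have "e ` {a<..h} \<subseteq> ?S" using assms by auto
  then have x': "x \<in> vec.span ?S" using x vec.span_mono by blast
  have I: "{1..i} = insert a ({1..i} - {a})" using idx(1) assms by auto
  have "moved x ` {1..i} = insert (e a + x) ?S"
    by (subst I) (auto simp: moved_def)
  moreover have "e ` {1..i} = insert (e a) ?S" by (subst I) auto
  ultimately show ?thesis unfolding moved_flag_def using span_insert_add[OF x'] by simp
qed

lemma form_rank_e:
  assumes "i \<le> CARD('n)" "j \<le> CARD('n)"
  shows "form_rank \<beta> (vec.span (e ` {1..i})) (vec.span (e ` {1..j})) = rk z i j"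
  using form_rank_normal_basis[OF nb assms] assms by (simp add: normal_basisD(2)[OF nb])

lemma card_columns: "card {t \<in> {1..j}. z t \<in> {1..i}} = rk z i j"
  using rk_commute[OF z, of j i] by (simp add: rk_def)

lemma card_insert_rows: "card (insert s {t \<in> {1..i}. z t \<in> {1..j}}) \<le> Suc (rk z i j)"
  using card_insert_le_m1[of "Suc (rk z i j)" "{t \<in> {1..i}. z t \<in> {1..j}}" s] by (simp add: rk_def)

lemma card_insert_columns: "card (insert s {t \<in> {1..j}. z t \<in> {1..i}}) \<le> Suc (rk z i j)"
  using card_insert_rows[of s j i] rk_commute[OF z, of j i] by simp

lemma subspace_moved_flag: "vec.subspace (moved_flag x i)"
  by (simp add: moved_flag_def)

text \<open>Reduces the conditions to pairs of indices that are both in the changed range. If only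
  one is, the cover may need the extra column \<open>a\<close>. For \<open>p \<le> i\<close> that
  column is counted by \<open>rk z\<close> already; for \<open>i < p\<close> it is needed only if
  \<open>x\<close> pairs with \<open>F i\<close>, and then \<open>outer\<close> supplies the spare
  rank.\<close>

lemma moved_rank_le:
  assumes x: "x \<in> vec.span (e ` {a<..h})" and hb: "a < h" "h \<le> CARD('n)"
    and low: "\<And>t. t \<in> {1..<a} \<Longrightarrow> \<beta> (e t) x = 0"
    and outer: "\<And>i j t. h \<le> i \<Longrightarrow> i < p \<Longrightarrow> a \<le> j \<Longrightarrow> j < h \<Longrightarrow> t \<in> {1..i} \<Longrightarrow> \<beta> (e t) x \<noteq> 0
      \<Longrightarrow> rk z i j < rk y i j"
    and inner: "\<And>i j. a \<le> j \<Longrightarrow> j \<le> i \<Longrightarrow> i < h \<Longrightarrow>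
      form_rank \<beta> (moved_flag x i) (moved_flag x j) \<le> rk y i j"
    and ij: "i \<le> CARD('n)" "j \<le> CARD('n)"
  shows "form_rank \<beta> (moved_flag x i) (moved_flag x j) \<le> rk y i j"
proof -
  have main: "form_rank \<beta> (moved_flag x i) (moved_flag x j) \<le> rk y i j"
    if ij: "i \<le> CARD('n)" "j \<le> i" for i j
  proof -
    have jn: "j \<le> CARD('n)" using ij by simp
    consider "j < a" | "a \<le> j" "i < h" | "a \<le> j" "j < h" "h \<le> i" | "h \<le> j" "h \<le> i"
      using ij by linarith
    then show ?thesis
    proof cases
      case 1
      have "form_rank \<beta> (moved_flag x i) (vec.span (e ` {1..j})) \<le> rk z i j"
        unfolding moved_flag_def
      proof (rule order_trans[OF form_rank_cover[where I' = "{t \<in> {1..i}. z t \<in> {1..j}}" and J' = "{}"]])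
        fix s t assume s: "s \<in> {1..i} - {t \<in> {1..i}. z t \<in> {1..j}}" and t: "t \<in> {1..j} - {}"
        then have "\<beta> (e s) (e t) = 0" using ij by (intro gram0) auto
        moreover have "\<beta> x (e t) = 0" using low[of t] t 1 form_zero_sym by auto
        ultimately show "\<beta> (moved x s) (e t) = 0" by (cases "s = a") (auto simp: moved_def)
      qed (auto simp: rk_def)
      then show ?thesis using rk_le[OF ij(1) jn] moved_flag_below[OF 1] by simp
    next
      case 2
      then show ?thesis using inner ij by simp
    next
      case 3
      let ?J = "{t \<in> {1..j}. z t \<in> {1..i}} \<union> (if p \<le> i \<or> (\<exists>t\<in>{1..i}. \<beta> (e t) x \<noteq> 0) then {a} else {})"
      have cover: "form_rank \<beta> (vec.span (e ` {1..i})) (moved_flag x j) \<le> card ?J"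
        unfolding moved_flag_def
      proof (rule order_trans[OF form_rank_cover[where I' = "{}" and J' = ?J]])
        fix s t assume s: "s \<in> {1..i} - {}" and t: "t \<in> {1..j} - ?J"
        have "\<beta> (e s) (e t) = 0"
          using s t ij z_eq_iff[of s t] by (intro gram0) auto
        moreover have "\<beta> (e s) x = 0" if "t = a" using s t that by (auto split: if_splits)
        ultimately show "\<beta> (e s) (moved x t) = 0" by (cases "t = a") (auto simp: moved_def)
      qed (use 3 idx in auto)
      have "card ?J \<le> rk y i j"
      proof (cases "p \<le> i \<or> \<not> (\<exists>t\<in>{1..i}. \<beta> (e t) x \<noteq> 0)")
        case True
        then have "?J = {t \<in> {1..j}. z t \<in> {1..i}}" using 3 idx by auto
        then show ?thesis using card_columns[of j i] rk_le[OF ij(1) jn] by simp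
      next
        case False
        then have "?J = insert a {t \<in> {1..j}. z t \<in> {1..i}}" by auto
        then have "card ?J \<le> Suc (rk z i j)" using card_insert_columns[of a j i] by simp
        moreover have "rk z i j < rk y i j" using outer[of i j] 3 False by auto
        ultimately show ?thesis by simp
      qed
      then show ?thesis using cover moved_flag_above[OF x hb(1) 3(3)] by simp
    next
      case 4
      then show ?thesis
        using moved_flag_above[OF x hb(1)] form_rank_e[OF ij(1) jn] rk_le[OF ij(1) jn] by simp
    qed
  qed
  show ?thesis
  proof (cases "j \<le> i")
    case False
    then show ?thesis
      using main[of j i] ij form_rank_commute[OF subspace_moved_flag subspace_moved_flag] rk_commute[OF y]
      by simp
  qed (use main ij in simp)
qed

text \<open>As \<open>j < p\<close>, \<open>rk z a j\<close> counts rows before \<open>a\<close>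
  only. They stay paired with the columns \<open>z t\<close>, while \<open>w\<close> is a partner
  for the new vector and is orthogonal to those rows.\<close>

lemma moved_rank_gt:
  assumes low: "\<And>t. t \<in> {1..<a} \<Longrightarrow> \<beta> (e t) x = 0" "\<And>t. t \<in> {1..<a} \<Longrightarrow> \<beta> (e (z t)) x = 0"
    and j: "j < p" and w: "w \<in> moved_flag x j" "\<beta> (e a + x) w \<noteq> 0"
    and w0: "\<And>t. t \<in> {1..<a} \<Longrightarrow> \<beta> (e t) w = 0"
  shows "rk z a j < form_rank \<beta> (moved_flag x a) (moved_flag x j)"
proof -
  let ?X = "{t \<in> {1..<a}. z t \<in> {1..j}}"
  have "{t \<in> {1..a}. z t \<in> {1..j}} \<subseteq> ?X" using j by (auto simp: order_le_less)
  then have "rk z a j \<le> card ?X" unfolding rk_def by (intro card_mono) auto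
  also have "\<dots> < card (insert a ?X)" by simp
  also have "\<dots> \<le> form_rank \<beta> (moved_flag x a) (moved_flag x j)"
  proof (rule card_le_form_rank[where v = "moved x" and w = "\<lambda>t. if t = a then w else e (z t)"])
    fix s assume s: "s \<in> insert a ?X"
    then show "moved x s \<in> moved_flag x a"
      unfolding moved_flag_def using idx by (intro vec.span_base) auto
    show "(if s = a then w else e (z s)) \<in> moved_flag x j"
    proof (cases "s = a")
      case False
      then have "z s \<noteq> a" "z s \<in> {1..j}" using s z_eq_iff[of s a] idx by auto
      then have "e (z s) = moved x (z s)" by (simp add: moved_def)
      then show ?thesis
        unfolding moved_flag_def using False \<open>z s \<in> {1..j}\<close> by (auto intro: vec.span_base)
    qed (use w in simp)
    fix t assume t: "t \<in> insert a ?X"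
    have n: "s \<in> {1..CARD('n)}" "t \<in> {1..CARD('n)}" "z t \<in> {1..CARD('n)}"
      using s t idx j by auto
    show "\<beta> (moved x s) (if t = a then w else e (z t)) \<noteq> 0 \<longleftrightarrow> s = t"
    proof (cases "s = a")
      case True
      have "\<beta> (e a + x) (e (z t)) = 0" if "t \<noteq> a"
      proof -
        have "\<beta> (e a) (e (z t)) = 0" using that n idx zz[of t] zz[of a] by (intro gram0) metis+
        moreover have "\<beta> x (e (z t)) = 0" using that t low(2)[of t] form_zero_sym by auto
        ultimately show ?thesis by simp
      qed
      then show ?thesis using True w by (auto simp: moved_def)
    next
      case False
      then have sa: "s \<in> {1..<a}" using s by auto
      have "\<beta> (e s) (e (z t)) \<noteq> 0 \<longleftrightarrow> s = t"
        using gram[OF n(1,3)] zz by metis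
      then show ?thesis using False w0[OF sa] by (auto simp: moved_def)
    qed
  qed (auto simp: subspace_moved_flag)
  finally show ?thesis .
qed


section \<open>Covers of the Gram matrix in the changed range\<close>

lemma moved_gram:
  assumes "s \<in> {1..CARD('n)}" "t \<in> {1..CARD('n)}"
  shows "s \<noteq> a \<Longrightarrow> t \<noteq> a \<Longrightarrow> t \<noteq> z s \<Longrightarrow> \<beta> (moved x s) (moved x t) = 0"
    "s \<noteq> a \<Longrightarrow> s \<noteq> p \<Longrightarrow> \<beta> (e s) x = 0 \<Longrightarrow> \<beta> (moved x s) (moved x a) = 0"
    "t \<noteq> a \<Longrightarrow> t \<noteq> p \<Longrightarrow> \<beta> (e t) x = 0 \<Longrightarrow> \<beta> (moved x a) (moved x t) = 0"
proof -
  show "\<beta> (moved x s) (moved x t) = 0" if "s \<noteq> a" "t \<noteq> a" "t \<noteq> z s"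
    using gram0[OF assms] that by (simp add: moved_def)
  have *: "\<beta> (moved x s) (moved x a) = 0" if "s \<in> {1..CARD('n)}" "s \<noteq> a" "s \<noteq> p" "\<beta> (e s) x = 0" for s
  proof -
    have "a \<noteq> z s" using that z_eq_iff[of s a] by auto
    then show ?thesis using gram0[OF that(1) idx(1)] that by (simp add: moved_def)
  qed
  then show "s \<noteq> a \<Longrightarrow> s \<noteq> p \<Longrightarrow> \<beta> (e s) x = 0 \<Longrightarrow> \<beta> (moved x s) (moved x a) = 0"
    using assms by blast
  show "t \<noteq> a \<Longrightarrow> t \<noteq> p \<Longrightarrow> \<beta> (e t) x = 0 \<Longrightarrow> \<beta> (moved x a) (moved x t) = 0"
    using *[OF assms(2)] form_zero_sym by blast
qed

lemma moved_cover:
  assumes "I' \<subseteq> {1..i}" "J' \<subseteq> {1..j}"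
    "\<And>s t. s \<in> {1..i} - I' \<Longrightarrow> t \<in> {1..j} - J' \<Longrightarrow> \<beta> (moved x s) (moved x t) = 0"
  shows "form_rank \<beta> (moved_flag x i) (moved_flag x j) \<le> card I' + card J'"
  unfolding moved_flag_def using assms by (intro form_rank_cover) auto

text \<open>For indices below \<open>p\<close> the vector \<open>e a\<close> pairs with no basis
  vector, and \<open>x\<close> pairs with none except possibly \<open>e a\<close>. So only the entry
  at \<open>(a, a)\<close> can change.\<close>

lemma inner_diagonal:
  assumes ij: "a \<le> j" "j \<le> i" "i < p" and x: "\<And>t. t \<in> {1..i} \<Longrightarrow> t \<noteq> a \<Longrightarrow> \<beta> (e t) x = 0"
  shows "form_rank \<beta> (moved_flag x i) (moved_flag x j) \<le> Suc (rk z i j)"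
    "\<beta> (e a + x) (e a + x) = 0 \<Longrightarrow> form_rank \<beta> (moved_flag x i) (moved_flag x j) \<le> rk z i j"
proof -
  let ?R = "{t \<in> {1..i}. z t \<in> {1..j}}"
  have 0: "\<beta> (moved x s) (moved x t) = 0" if "s \<in> {1..i} - ?R" "t \<in> {1..j}" "s \<noteq> a \<or> t \<noteq> a" for s t
  proof -
    have n: "s \<in> {1..CARD('n)}" "t \<in> {1..CARD('n)}" "t \<noteq> z s" "s \<noteq> p" "t \<noteq> p" "t \<in> {1..i}" "s \<in> {1..i}"
      using that ij idx by auto
    from that(3) consider "s \<noteq> a" "t \<noteq> a" | "s = a" "t \<noteq> a" | "s \<noteq> a" "t = a" by blast
    then show ?thesis
      by cases (use moved_gram[OF n(1,2)] n x in auto)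
  qed
  have "form_rank \<beta> (moved_flag x i) (moved_flag x j) \<le> card (insert a ?R) + card ({} :: nat set)"
    by (rule moved_cover) (use 0 ij idx in auto)
  then show "form_rank \<beta> (moved_flag x i) (moved_flag x j) \<le> Suc (rk z i j)"
    using card_insert_rows[of a i j] by simp
  assume iso: "\<beta> (e a + x) (e a + x) = 0"
  have "form_rank \<beta> (moved_flag x i) (moved_flag x j) \<le> card ?R + card ({} :: nat set)"
  proof (rule moved_cover)
    fix s t assume st: "s \<in> {1..i} - ?R" "t \<in> {1..j} - {}"
    show "\<beta> (moved x s) (moved x t) = 0"
    proof (cases "s = a \<and> t = a")
      case True
      then show ?thesis using iso by (simp only: moved_def fun_upd_same)
    next
      case False
      then show ?thesis using 0 st by blast
    qed
  qed auto
  then show "form_rank \<beta> (moved_flag x i) (moved_flag x j) \<le> rk z i j" by (simp add: rk_def)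
qed

text \<open>Off the diagonal, new entries can occur only at \<open>(a, b)\<close> and
  \<open>(b, a)\<close>. For \<open>b \<le> j\<close> row \<open>b\<close> is counted already and
  row \<open>a\<close> is added; for \<open>j < b\<close> the entry \<open>(a, b)\<close> lies
  outside and column \<open>a\<close> is added.\<close>

lemma inner_fixed:
  assumes "z b = b" and ij: "a \<le> j" "j \<le> i" "i < p"
    and x: "\<And>t. t \<in> {1..i} \<Longrightarrow> t \<noteq> a \<Longrightarrow> t \<noteq> b \<Longrightarrow> \<beta> (e t) x = 0"
    and iso: "\<beta> (e a + x) (e a + x) = 0"
  shows "form_rank \<beta> (moved_flag x i) (moved_flag x j) \<le> Suc (rk z i j)"
proof (cases "b \<le> j")
  case True
  let ?R = "insert a {t \<in> {1..i}. z t \<in> {1..j}}"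
  have "form_rank \<beta> (moved_flag x i) (moved_flag x j) \<le> card ?R + card ({} :: nat set)"
  proof (rule moved_cover)
    fix s t assume st: "s \<in> {1..i} - ?R" "t \<in> {1..j} - {}"
    then have n: "s \<in> {1..CARD('n)}" "t \<in> {1..CARD('n)}" "t \<noteq> z s" "s \<noteq> p" "s \<noteq> a" "s \<noteq> b" "s \<in> {1..i}"
      using ij idx True assms(1) by auto
    then show "\<beta> (moved x s) (moved x t) = 0"
      using moved_gram(1,2)[OF n(1,2)] x[of s] by (cases "t = a") auto
  qed (use ij idx in auto)
  then show ?thesis using card_insert_rows[of a i j] by simp
next
  case False
  let ?R = "{t \<in> {1..i}. z t \<in> {1..j}}"
  have "form_rank \<beta> (moved_flag x i) (moved_flag x j) \<le> card ?R + card {a}"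
  proof (rule moved_cover)
    fix s t assume st: "s \<in> {1..i} - ?R" "t \<in> {1..j} - {a}"
    then have n: "s \<in> {1..CARD('n)}" "t \<in> {1..CARD('n)}" "t \<noteq> z s" "t \<noteq> p" "t \<noteq> a" "t \<noteq> b" "t \<in> {1..i}"
      using ij idx False by auto
    then show "\<beta> (moved x s) (moved x t) = 0"
      using moved_gram(1,3)[OF n(1,2)] x[of t] by (cases "s = a") auto
  qed (use ij idx in auto)
  then show ?thesis by (simp add: rk_def)
qed

text \<open>New entries can occur only at \<open>(a, z b)\<close> and \<open>(z b, a)\<close>. How
  many lines they cost depends on the position of \<open>z b\<close> and \<open>p\<close> relative
  to \<open>i\<close> and \<open>j\<close>; \<open>gap_rows\<close> pays for one and
  \<open>gap_square\<close> for two.\<close>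

lemma inner_crossing:
  assumes q: "a < y a" and zb': "z b \<noteq> b" and ij: "a \<le> j" "j \<le> i" "i < b"
    and x: "\<And>t. t \<in> {1..CARD('n)} \<Longrightarrow> t \<noteq> z b \<Longrightarrow> \<beta> (e t) x = 0"
    and iso: "\<beta> (e a + x) (e a + x) = 0"
  shows "form_rank \<beta> (moved_flag x i) (moved_flag x j) \<le> rk y i j"
proof -
  have n: "i \<le> CARD('n)" "j \<le> CARD('n)" using ij idx by auto
  have le: "rk z i j \<le> rk y i j" using rk_le n by simp
  let ?R = "{t \<in> {1..i}. z t \<in> {1..j}}" and ?C = "{t \<in> {1..j}. z t \<in> {1..i}}"
  have ca: "z b \<noteq> a" using zb q by simp
  have bp: "b \<noteq> p" using ca zz[of a] by auto
  have aa: "\<beta> (moved x a) (moved x a) = 0" using iso by (simp only: moved_def fun_upd_same)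
  show ?thesis
  proof (cases "z b \<le> i")
    case False
    have "form_rank \<beta> (moved_flag x i) (moved_flag x j) \<le> card ?R + card ({} :: nat set)"
    proof (rule moved_cover)
      fix s t assume st: "s \<in> {1..i} - ?R" "t \<in> {1..j} - {}"
      then have n: "s \<in> {1..CARD('n)}" "t \<in> {1..CARD('n)}" "t \<noteq> z s" "s \<noteq> p"
        "s \<noteq> z b" "t \<noteq> z b"
        using ij idx False by auto
      consider "s \<noteq> a" "t \<noteq> a" | "s = a" "t \<noteq> a" | "s \<noteq> a" "t = a" | "s = a" "t = a" by blast
      then show "\<beta> (moved x s) (moved x t) = 0"
        by cases (use moved_gram[OF n(1,2)] n x aa in auto)
    qed auto
    then show ?thesis using le by (simp add: rk_def)
  next
    case ci: True
    \<comment> \<open>Otherwise the row \<open>z b\<close>, which comes before \<open>b\<close> and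
      has its entry in column \<open>b\<close>, would contradict the choice of
      \<open>b\<close>.\<close>
    have pb: "p < b"
      using b_least[of "z b"] ci ij idx ca zb bp by force
    show ?thesis
    proof (cases "j < z b")
      case True
      have "form_rank \<beta> (moved_flag x i) (moved_flag x j) \<le> card ({} :: nat set) + card (insert a ?C)"
      proof (rule moved_cover)
        fix s t assume st: "s \<in> {1..i} - {}" "t \<in> {1..j} - insert a ?C"
        then have n: "s \<in> {1..CARD('n)}" "t \<in> {1..CARD('n)}" "t \<noteq> z s" "t \<noteq> a" "t \<noteq> p" "t \<noteq> z b"
          using ij idx True zb zz by auto
        then show "\<beta> (moved x s) (moved x t) = 0"
          using moved_gram(1,3)[OF n(1,2)] x[of t] by (cases "s = a") auto
      qed (use ij idx in auto)
      moreover have "card (insert a ?C) \<le> rk y i j"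
      proof (cases "p \<le> i")
        case True
        then have "insert a ?C = ?C" using ij idx by auto
        then show ?thesis using le card_columns[of j i] by simp
      next
        case False
        have "rk z j i < rk y j i" using gap_rows[of j i] ij ci zb False by simp
        then show ?thesis
          using card_insert_columns[of a j i] rk_commute[OF y, of i j] rk_commute[OF z, of i j] by simp
      qed
      ultimately show ?thesis by simp
    next
      case False
      have 0: "\<beta> (moved x s) (moved x t) = 0"
        if "s \<in> {1..i}" "t \<in> {1..j}" "s \<notin> ?R - {p}" "t \<noteq> a" "s \<noteq> a" for s t
      proof -
        have n: "s \<in> {1..CARD('n)}" "t \<in> {1..CARD('n)}" "t \<noteq> z s"
          using that ij idx zz[of a] by auto
        then show ?thesis using moved_gram(1)[OF n(1,2)] that by auto
      qed
      have cov: "form_rank \<beta> (moved_flag x i) (moved_flag x j) \<le> card (insert a (?R - {p})) + card {a}"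
        by (rule moved_cover) (use 0 ij idx in auto)
      have pR: "p \<in> ?R \<longleftrightarrow> p \<le> i" and aR: "a \<in> ?R \<longleftrightarrow> p \<le> j"
        using ij idx by auto
      consider "p \<le> j" | "j < p" "p \<le> i" | "i < p" by linarith
      then show ?thesis
      proof cases
        case 1
        then have "insert a (?R - {p}) = ?R - {p}" using aR idx by auto
        moreover have "p \<in> ?R" unfolding pR using 1 ij by simp
        then have "card (?R - {p}) < card ?R" by (rule card_Diff1_less[rotated]) simp
        ultimately show ?thesis using cov le by (simp add: rk_def)
      next
        case 2
        then have "p \<in> ?R" unfolding pR by simp
        then have "card (?R - {p}) < card ?R" by (rule card_Diff1_less[rotated]) simp
        then have "card (insert a (?R - {p})) \<le> rk z i j"
          by (simp add: rk_def card_insert_if)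
        moreover have "rk z i j < rk y i j" using gap_rows[of i j] ij 2 False zb by simp
        ultimately show ?thesis using cov by simp
      next
        case 3
        have "?R - {p} = ?R" using 3 by auto
        then have "card (insert a (?R - {p})) \<le> Suc (rk z i j)"
          using card_insert_rows[of a i j] by simp
        moreover have "rk z i j + 2 \<le> rk y i j" using gap_square[of i j] q ij 3 False zb by simp
        ultimately show ?thesis using cov by simp
      qed
    qed
  qed
qed


section \<open>Moves that respect the conditions and raise a rank\<close>

definition good_move :: "complex ^ 'n \<Rightarrow> bool" where
  "good_move x \<longleftrightarrow> x \<in> vec.span (e ` {a<..CARD('n)}) \<and>
     (\<forall>i\<le>CARD('n). \<forall>j\<le>CARD('n). form_rank \<beta> (moved_flag x i) (moved_flag x j) \<le> rk y i j) \<and>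
     (\<exists>j\<le>CARD('n). rk z a j < form_rank \<beta> (moved_flag x a) (moved_flag x j))"

lemma gap_columns: "a \<le> j \<Longrightarrow> j < b \<Longrightarrow> y a \<le> i \<Longrightarrow> i < p \<Longrightarrow> rk z i j < rk y i j"
  using gap_rows[of j i] rk_commute[OF y, of i j] rk_commute[OF z, of i j] by simp

lemma gram_aa: "\<beta> (e a) (e a) = 0"
  using idx by (intro gram0) auto

lemma in_moved_flag: "t \<in> {1..j} \<Longrightarrow> moved x t \<in> moved_flag x j"
  unfolding moved_flag_def by (intro vec.span_base) auto

lemma span_later: "x \<in> vec.span (e ` {a<..h}) \<Longrightarrow> h \<le> k \<Longrightarrow> x \<in> vec.span (e ` {a<..k})"
  by (rule subsetD[OF vec.span_mono[OF image_mono]]) auto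

text \<open>After the move, the vector in position \<open>a\<close> pairs with the one in position
  \<open>z b\<close>, which is earlier than \<open>p\<close>; this raises the rank at
  \<open>(a, z b)\<close>.\<close>

lemma good_move_exchange:
  assumes s: "s \<noteq> 0" and fixpt: "y a = a \<Longrightarrow> \<epsilon> = 1" and zb': "y a = a \<or> z b \<noteq> b"
  shows "good_move (s *s e b)"
proof -
  let ?x = "s *s e b"
  have supp: "\<beta> (e t) ?x = 0" if "t \<in> {1..CARD('n)}" "t \<noteq> z b" for t
    using gram0[OF that(1) idx(2)] that(2) z_eq_iff[of t b] by simp
  have x: "?x \<in> vec.span (e ` {a<..b})" using ab by (intro vec.span_scale vec.span_base) auto
  then have "?x \<in> vec.span (e ` {a<..CARD('n)})"
    by (rule span_later) (use idx in auto)
  moreover have "form_rank \<beta> (moved_flag ?x i) (moved_flag ?x j) \<le> rk y i j"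
    if "i \<le> CARD('n)" "j \<le> CARD('n)" for i j
  proof (rule moved_rank_le[OF x ab _ _ _ _ that])
    show "b \<le> CARD('n)" using idx by simp
    show "\<beta> (e t) ?x = 0" if "t \<in> {1..<a}" for t
      using that idx by (intro supp) auto
    show "rk z i j < rk y i j"
      if "b \<le> i" "i < p" "a \<le> j" "j < b" "t \<in> {1..i}" "\<beta> (e t) ?x \<noteq> 0" for i j t
    proof -
      have "t = z b" using supp[of t] that idx by force
      then show ?thesis using that zb by (intro gap_columns) auto
    qed
    fix i j assume ij: "a \<le> j" "j \<le> i" "i < b"
    show "form_rank \<beta> (moved_flag ?x i) (moved_flag ?x j) \<le> rk y i j"
    proof (cases "y a = a")
      case True
      have bp: "b \<le> p" using b_least[of p] idx True by simp
      have "\<beta> (e t) ?x = 0" if t: "t \<in> {1..i}" "t \<noteq> a" for t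
      proof (rule supp)
        show "t \<in> {1..CARD('n)}" using t ij idx by auto
        show "t \<noteq> z b"
        proof
          assume "t = z b"
          then have "b \<noteq> p" using t idx by auto
          then show False using b_least[of t] t ij bp ab True idx zb \<open>t = z b\<close> by auto
        qed
      qed
      \<comment> \<open>For \<open>y a = a\<close> the new vector may be anisotropic;
        \<open>gap_rows\<close> pays for the entry at \<open>(a, a)\<close>.\<close>
      then have "form_rank \<beta> (moved_flag ?x i) (moved_flag ?x j) \<le> Suc (rk z i j)"
        using ij bp by (intro inner_diagonal(1)) auto
      also have "\<dots> \<le> rk y i j" using gap_rows[of i j] ij bp True by simp
      finally show ?thesis .
    next
      case False
      then have q: "a < y a" using a_le by simp
      have "z b \<noteq> a" using q zb by simp
      then have "b \<noteq> p" using idx by auto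
      then have "\<beta> (e a) (e b) = 0" "\<beta> (e b) (e b) = 0"
        using gram0[OF idx(1,2)] gram0[OF idx(2,2)] zb' False by auto
      then have "\<beta> (e a + ?x) (e a + ?x) = 0"
        using gram_aa form_zero_sym[of "e a" "e b"] by simp
      then show ?thesis using q zb' False ij supp by (intro inner_crossing) auto
    qed
  qed
  moreover have "rk z a (z b) < form_rank \<beta> (moved_flag ?x a) (moved_flag ?x (z b))"
  proof (rule moved_rank_gt[where w = "moved ?x (z b)"])
    show "\<beta> (e t) ?x = 0" if "t \<in> {1..<a}" for t
      using that idx by (intro supp) auto
    show "\<beta> (e (z t)) ?x = 0" if "t \<in> {1..<a}" for t
      using that idx ab zz[of t] I_O_D(3)[OF z, of t] by (intro supp) auto
    show "z b < p" by (rule zb)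
    show "moved ?x (z b) \<in> moved_flag ?x (z b)" using idx by (intro in_moved_flag) auto
    show "\<beta> (e a + ?x) (moved ?x (z b)) \<noteq> 0"
    proof (cases "z b = a")
      case True
      \<comment> \<open>Here the new vector must pair with itself. In the symmetric case its square
        is \<open>2 * s * \<beta> (e a) (e p)\<close>; in the skew case it would be zero.\<close>
      then have "b = p" using idx by auto
      then have bb: "\<beta> (e b) (e b) = 0" "\<beta> (e a) (e b) \<noteq> 0" using gram0[OF idx(2,2)] gram[OF idx(1,2)] idx by auto
      have "\<epsilon> = 1" using True zb a_le by (intro fixpt) simp
      then have "\<beta> (e b) (e a) = \<beta> (e a) (e b)" using eps_sym[of "e b" "e a"] by simp
      then show ?thesis using True s bb gram_aa by (simp add: moved_simps)
    next
      case False
      have "\<beta> (e a) (e (z b)) = 0" "\<beta> (e b) (e (z b)) \<noteq> 0"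
        using gram0[OF idx(1,4)] gram[OF idx(2,4)] zb by auto
      then show ?thesis using False s by (simp add: moved_simps)
    qed
    show "\<beta> (e t) (moved ?x (z b)) = 0" if t: "t \<in> {1..<a}" for t
    proof -
      have tn: "t \<in> {1..CARD('n)}" "t \<noteq> b" "t \<noteq> p" using t idx ab by auto
      then have "\<beta> (e t) (e (z b)) = 0" "\<beta> (e t) (e a) = 0"
        using gram0[OF tn(1) idx(4)] gram0[OF tn(1) idx(1)] zz z_eq_iff by metis+
      moreover have "\<beta> (e t) ?x = 0" using t idx by (intro supp) auto
      ultimately show ?thesis by (cases "z b = a") (auto simp: moved_simps)
    qed
  qed
  moreover have "z b \<le> CARD('n)" using idx by simp
  ultimately show ?thesis unfolding good_move_def by blast
qed

text \<open>The common part of three choices of \<open>x\<close>. Below index \<open>b\<close>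
  isotropy of the new vector keeps the ranks within \<open>rk z\<close>; from \<open>b\<close> to
  \<open>d - 1\<close> one extra line is needed, and one spare rank is available. The vector
  \<open>e k\<close> witnesses the growth of the rank at \<open>(a, k)\<close>.\<close>

lemma good_move_fixed:
  assumes q: "a < y a" and fb: "z b = b" and d: "b < d" "d \<le> p"
    and d_least: "\<And>t. b < t \<Longrightarrow> b \<le> z t \<Longrightarrow> z t < p \<Longrightarrow> d \<le> t"
    and x: "x \<in> vec.span (e ` {a<..d})"
    and supp: "\<And>t. t \<in> {1..CARD('n)} \<Longrightarrow> \<beta> (e t) x \<noteq> 0 \<Longrightarrow> t = a \<or> t = b \<or> d \<le> t"
    and supp': "\<And>t. t \<in> {1..<a} \<Longrightarrow> \<beta> (e (z t)) x = 0"
    and iso: "\<beta> (e a + x) (e a + x) = 0"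
    and k: "k \<in> {1..CARD('n)}" "k < p" "k \<noteq> a" "a \<le> z k" "\<beta> x (e k) \<noteq> 0"
  shows "good_move x"
proof -
  have dn: "d \<le> CARD('n)" and ad: "a < d" and yb: "y a \<le> b" using d idx ab zb fb by auto
  have low: "\<beta> (e t) x = 0" if "t \<in> {1..<a}" for t
    using supp[of t] that ad ab idx by auto
  have gap: "rk z i j < rk y i j" if "b \<le> i" "i < p" "a \<le> j" "j < d" for i j
  proof (cases "j < b")
    case True
    then show ?thesis using that yb by (intro gap_columns) auto
  next
    case False
    show ?thesis by (rule gap_fixpoint[OF q fb _ _ _ _ d_least d(2)]) (use that False in auto)
  qed
  have "x \<in> vec.span (e ` {a<..CARD('n)})"
    using x dn by (rule span_later)
  moreover have "form_rank \<beta> (moved_flag x i) (moved_flag x j) \<le> rk y i j"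
    if "i \<le> CARD('n)" "j \<le> CARD('n)" for i j
  proof (rule moved_rank_le[OF x ad dn low _ _ that])
    show "rk z i j < rk y i j" if "d \<le> i" "i < p" "a \<le> j" "j < d" for i j
      using that d by (intro gap) auto
    fix i j assume ij: "a \<le> j" "j \<le> i" "i < d"
    have n: "i \<le> CARD('n)" "j \<le> CARD('n)" using ij dn by auto
    show "form_rank \<beta> (moved_flag x i) (moved_flag x j) \<le> rk y i j"
    proof (cases "i < b")
      case True
      have "form_rank \<beta> (moved_flag x i) (moved_flag x j) \<le> rk z i j"
      proof (rule inner_diagonal(2)[OF ij(1,2) _ _ iso])
        show "\<beta> (e t) x = 0" if "t \<in> {1..i}" "t \<noteq> a" for t
          using supp[of t] that True d n by auto
      qed (use ij d in auto)
      then show ?thesis using rk_le[OF n] by simp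
    next
      case False
      have "form_rank \<beta> (moved_flag x i) (moved_flag x j) \<le> Suc (rk z i j)"
      proof (rule inner_fixed[OF fb ij(1,2) _ _ iso])
        show "\<beta> (e t) x = 0" if "t \<in> {1..i}" "t \<noteq> a" "t \<noteq> b" for t
          using supp[of t] that ij n by auto
      qed (use ij d in auto)
      also have "\<dots> \<le> rk y i j" using gap[of i j] False ij d by simp
      finally show ?thesis .
    qed
  qed
  moreover have "rk z a k < form_rank \<beta> (moved_flag x a) (moved_flag x k)"
  proof (rule moved_rank_gt[OF low supp' k(2), where w = "e k"])
    show "e k \<in> moved_flag x k" using in_moved_flag[of k k x] k by (simp add: moved_simps)
    have "\<beta> (e a) (e k) = 0" using gram0[OF idx(1) k(1)] k by simp
    then show "\<beta> (e a + x) (e k) \<noteq> 0" using k by simp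
    show "\<beta> (e t) (e k) = 0" if "t \<in> {1..<a}" for t
      using that k idx zz[of t] by (intro gram0) auto
  qed
  ultimately show ?thesis unfolding good_move_def using k by auto
qed

text \<open>Here \<open>y a > a\<close> forces the new basis vector to be isotropic, which \<open>e a + s *s e b\<close> is not.
  Let \<open>d > b\<close> be the next row with an entry in the columns from \<open>b\<close> to \<open>p - 1\<close>. If there is none,
  a multiple of \<open>e p\<close> corrects this, if \<open>z d = d\<close>, a multiple of \<open>e d\<close> does, and otherwise
  \<open>e d\<close> is added instead of \<open>e b\<close>.\<close>

lemma good_moves_fixed:
  assumes q: "a < y a" and fb: "z b = b"
  shows "\<exists>u w. \<forall>s. s \<noteq> 0 \<longrightarrow> good_move (s *s u + s\<^sup>2 *s w)"
proof -
  have bp: "b < p" and ya: "y a \<le> b" using zb fb by auto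
  have bb: "\<beta> (e b) (e b) \<noteq> 0" using gram[OF idx(2,2)] fb by simp
  then have eps1: "\<epsilon> = 1" using eps eps_sym[of "e b" "e b"] by auto
  have ap: "\<beta> (e a) (e p) \<noteq> 0" "\<beta> (e p) (e a) = \<beta> (e a) (e p)"
    using gram[OF idx(1,3)] eps_sym[of "e p" "e a"] eps1 by auto
  have pp: "\<beta> (e p) (e p) = 0" using gram0[OF idx(3,3)] idx by simp
  have ba: "\<beta> (e a) (e b) = 0" "\<beta> (e b) (e a) = 0" "\<beta> (e p) (e b) = 0" "\<beta> (e b) (e p) = 0"
    using gram0[OF idx(1,2)] gram0[OF idx(2,1)] gram0[OF idx(3,2)] gram0[OF idx(2,3)] fb bp ab idx by auto
  \<comment> \<open>Admitting \<open>t = p\<close> makes the minimum exist and caps \<open>d\<close>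
    at \<open>p\<close>, even if the next row of the required kind lies beyond
    \<open>p\<close>.\<close>
  define P where "P t \<longleftrightarrow> b < t \<and> (t = p \<or> b \<le> z t \<and> z t < p)" for t
  define d where "d = (LEAST t. P t)"
  have "P p" using bp by (simp add: P_def)
  then have "P d" and dp: "d \<le> p" and d_least: "\<And>t. P t \<Longrightarrow> d \<le> t"
    unfolding d_def by (auto intro: LeastI Least_le)
  then have bd: "b < d" by (simp add: P_def)
  have d_least': "d \<le> t" if "b < t" "b \<le> z t" "z t < p" for t
    using that d_least by (simp add: P_def)
  have dn: "d \<in> {1..CARD('n)}" using dp bd idx by auto
  have supp_e: "\<beta> (e t) (e k) = 0" if "t \<in> {1..CARD('n)}" "k \<in> {1..CARD('n)}" "t \<noteq> z k" for t k
    using gram0[OF that(1,2)] that(3) zz by metis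
  have zt: "z t \<in> {1..CARD('n)}" "z t \<noteq> z k" if "t \<in> {1..<a}" "a \<le> k" for t k
  proof -
    show "z t \<in> {1..CARD('n)}" using that(1) idx I_O_D(3)[OF z, of t] by auto
    show "z t \<noteq> z k" using that zz[of t] zz[of k] by auto
  qed
  show ?thesis
  proof (cases "d = p")
    case True
    \<comment> \<open>Solves
      \<open>\<beta> (e b) (e b) + 2 * \<kappa> * \<beta> (e a) (e p) = 0\<close>, the isotropy
      condition divided by the square of \<open>s\<close>.\<close>
    define \<kappa> where "\<kappa> = - \<beta> (e b) (e b) / (2 * \<beta> (e a) (e p))"
    have "good_move (s *s e b + s\<^sup>2 *s (\<kappa> *s e p))" (is "good_move ?x") if s: "s \<noteq> 0" for s
    proof (rule good_move_fixed[OF q fb bd dp d_least'])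
      show "?x \<in> vec.span (e ` {a<..d})"
        unfolding True using ab bp by (intro vec.span_add vec.span_scale vec.span_base) auto
      show "t = a \<or> t = b \<or> d \<le> t" if "t \<in> {1..CARD('n)}" "\<beta> (e t) ?x \<noteq> 0" for t
        using supp_e[OF that(1) idx(2)] supp_e[OF that(1) idx(3)] that(2) fb idx by fastforce
      show "\<beta> (e (z t)) ?x = 0" if "t \<in> {1..<a}" for t
        using supp_e[OF zt(1)[OF that order_refl] idx(2)] supp_e[OF zt(1)[OF that order_refl] idx(3)]
          zt(2)[OF that, of b] zt(2)[OF that, of p] idx(7) ab by simp
      show "\<beta> (e a + ?x) (e a + ?x) = 0"
        using ap pp ba gram_aa by (simp add: \<kappa>_def power2_eq_square)
      show "b \<in> {1..CARD('n)}" "b < p" "b \<noteq> a" "a \<le> z b" using idx bp ab by auto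
      show "\<beta> ?x (e b) \<noteq> 0" using bb s ba by simp
    qed
    then show ?thesis by (intro exI allI impI)
  next
    case dp': False
    then have zd: "b \<le> z d" "z d < p" using \<open>P d\<close> by (auto simp: P_def)
    have zdn: "z d \<in> {1..CARD('n)}" using dn I_O_D(3)[OF z, of d] by simp
    have ad: "\<beta> (e a) (e d) = 0" "\<beta> (e d) (e a) = 0"
      using gram0[OF idx(1) dn] dp' form_zero_sym by auto
    show ?thesis
    proof (cases "z d = d")
      case True
      have dd: "\<beta> (e d) (e d) \<noteq> 0" using gram[OF dn dn] True by simp
      have bd0: "\<beta> (e b) (e d) = 0" "\<beta> (e d) (e b) = 0"
        using gram0[OF idx(2) dn] gram0[OF dn idx(2)] fb True bd by auto
      \<comment> \<open>The vectors \<open>e a\<close>, \<open>e b\<close> and \<open>e d\<close>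
        are mutually orthogonal and \<open>e a\<close> is isotropic, so only the squares of
        \<open>e b\<close> and \<open>e d\<close> have to cancel.\<close>
      define \<kappa> where "\<kappa> = csqrt (- \<beta> (e b) (e b) / \<beta> (e d) (e d))"
      have \<kappa>: "\<kappa> * \<kappa> * \<beta> (e d) (e d) = - \<beta> (e b) (e b)"
        using dd power2_csqrt[of "- \<beta> (e b) (e b) / \<beta> (e d) (e d)"]
        unfolding \<kappa>_def power2_eq_square by simp
      have "good_move (s *s (e b + \<kappa> *s e d) + s\<^sup>2 *s 0)" (is "good_move ?x") if s: "s \<noteq> 0" for s
      proof (rule good_move_fixed[OF q fb bd dp d_least'])
        show "?x \<in> vec.span (e ` {a<..d})"
          using ab bd by (intro vec.span_add vec.span_scale vec.span_zero vec.span_base) auto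
        show "t = a \<or> t = b \<or> d \<le> t" if "t \<in> {1..CARD('n)}" "\<beta> (e t) ?x \<noteq> 0" for t
          using supp_e[OF that(1) idx(2)] supp_e[OF that(1) dn] that(2) fb True by fastforce
        show "\<beta> (e (z t)) ?x = 0" if "t \<in> {1..<a}" for t
          using supp_e[OF zt(1)[OF that order_refl] idx(2)] supp_e[OF zt(1)[OF that order_refl] dn]
            zt(2)[OF that, of b] zt(2)[OF that, of d] ab bd by simp
        have "\<beta> (e a + ?x) (e a + ?x) = s * (s * (\<beta> (e b) (e b) + \<kappa> * \<kappa> * \<beta> (e d) (e d)))"
          using ad ba bd0 gram_aa by (simp add: algebra_simps)
        then show "\<beta> (e a + ?x) (e a + ?x) = 0" using \<kappa> by simp
        show "b \<in> {1..CARD('n)}" "b < p" "b \<noteq> a" "a \<le> z b" using idx bp ab by auto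
        show "\<beta> ?x (e b) \<noteq> 0" using bb s bd0 by simp
      qed
      then show ?thesis by (intro exI allI impI)
    next
      case False
      \<comment> \<open>Otherwise the row \<open>z d\<close>, with its entry in column
        \<open>d < p\<close>, would be a smaller candidate than \<open>d\<close>.\<close>
      have dz: "d < z d"
      proof (rule ccontr)
        assume "\<not> d < z d"
        then have "z d < d" using False by simp
        moreover have "b < z d" using zd bd fb zz[of d] by (cases "z d = b") auto
        ultimately show False using d_least'[of "z d"] zz[of d] bd dp dp' by simp
      qed
      have dd: "\<beta> (e d) (e d) = 0" using gram0[OF dn dn] False by simp
      have "good_move (s *s e d + s\<^sup>2 *s 0)" (is "good_move ?x") if s: "s \<noteq> 0" for s
      proof (rule good_move_fixed[OF q fb bd dp d_least'])
        show "?x \<in> vec.span (e ` {a<..d})"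
          using ab bd by (intro vec.span_add vec.span_scale vec.span_zero vec.span_base) auto
        show "t = a \<or> t = b \<or> d \<le> t" if "t \<in> {1..CARD('n)}" "\<beta> (e t) ?x \<noteq> 0" for t
          using supp_e[OF that(1) dn] that(2) dz by auto
        show "\<beta> (e (z t)) ?x = 0" if "t \<in> {1..<a}" for t
          using supp_e[OF zt(1)[OF that order_refl] dn] zt(2)[OF that, of d] ab bd by simp
        show "\<beta> (e a + ?x) (e a + ?x) = 0" using ad dd gram_aa by simp
        show "z d \<in> {1..CARD('n)}" "z d < p" "z d \<noteq> a" "a \<le> z (z d)"
          using zdn zd ab bd zz[of d] by auto
        show "\<beta> ?x (e (z d)) \<noteq> 0" using gram[OF dn zdn] s by simp
      qed
      then show ?thesis by (intro exI allI impI)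
    qed
  qed
qed

text \<open>Without a constant term the moves tend to zero with \<open>s\<close>. The quadratic term
  accommodates the correction along \<open>e p\<close>, which is of second order because
  \<open>e p\<close> pairs with \<open>e a\<close> itself.\<close>

lemma good_moves_exist:
  assumes fixpt: "y a = a \<Longrightarrow> \<epsilon> = 1"
  shows "\<exists>u w. \<forall>s. s \<noteq> 0 \<longrightarrow> good_move (s *s u + s\<^sup>2 *s w)"
proof (cases "y a = a \<or> z b \<noteq> b")
  case True
  then have "\<forall>s. s \<noteq> 0 \<longrightarrow> good_move (s *s e b + s\<^sup>2 *s 0)"
    using good_move_exchange fixpt by simp
  then show ?thesis by (intro exI)
next
  case False
  then show ?thesis using a_le by (intro good_moves_fixed) auto
qed

end

section \<open>Orbit closures\<close>

context eps_form
begin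

lemma closure_contains:
  assumes Z: "zariski_closed Z" "orbit \<beta> y \<subseteq> Z" and y: "y \<in> I_O CARD('n)"
    and fpf: "\<epsilon> = -1 \<Longrightarrow> y \<in> I_Sp CARD('n)"
    and "F \<in> Fl" and "\<And>i j. i \<le> CARD('n) \<Longrightarrow> j \<le> CARD('n) \<Longrightarrow> form_rank \<beta> (F i) (F j) \<le> rk y i j"
  shows "F \<in> Z"
  using assms(5,6)
proof (induction "\<Sum>(i, j)\<in>{..CARD('n)} \<times> {..CARD('n)}. rk y i j - form_rank \<beta> (F i) (F j)"
    arbitrary: F rule: less_induct)
  case (less F)
  let ?n = "CARD('n)"
  note F = less.prems(1)
  obtain e z where nb: "normal_basis e z F" by (rule normal_basis_exists[OF F])
  have z: "z \<in> I_O ?n" by (rule normal_basisD(1)[OF nb])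
  have rF: "form_rank \<beta> (F i) (F j) = rk z i j" if "i \<le> ?n" "j \<le> ?n" for i j
    by (rule form_rank_normal_basis[OF nb that])
  have rk_le: "rk z i j \<le> rk y i j" if "i \<le> ?n" "j \<le> ?n" for i j
    using less.prems(2)[OF that] rF[OF that] by simp
  show ?case
  proof (cases "z = y")
    case True
    then have "F \<in> orbit \<beta> y" using F rF by (simp add: orbit_def)
    then show ?thesis using Z(2) by blast
  next
    case False
    obtain a b where gap: "involution_gap ?n y z a b"
      by (rule involution_gap_exists[OF y z False rk_le])
    interpret flag_move \<beta> \<epsilon> y z a b F e
      using eps_form_axioms gap F nb by (intro flag_move.intro flag_move_axioms.intro)
    have "\<epsilon> = 1" if "y a = a"
      using fpf eps that idx(1) by (auto simp: I_Sp_def)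
    from good_moves_exist[OF this] obtain u w
      where uw: "\<And>s. s \<noteq> 0 \<Longrightarrow> good_move (s *s u + s\<^sup>2 *s w)" by blast
    define s :: "nat \<Rightarrow> complex" where "s m = 1 / of_nat (Suc m)" for m
    define X where "X m = s m *s u + (s m)\<^sup>2 *s w" for m
    have X: "good_move (X m)" for m
      unfolding X_def by (rule uw) (simp add: s_def del: of_nat_Suc)
    have "s \<longlonglongrightarrow> 0"
      unfolding s_def by (rule LIMSEQ_Suc[OF lim_1_over_n])
    then have "(\<lambda>m. s m * u $ k + (s m)\<^sup>2 * w $ k) \<longlonglongrightarrow> 0 * u $ k + 0\<^sup>2 * w $ k" for k
      by (intro tendsto_add tendsto_mult tendsto_power tendsto_const)
    then have X_lim: "(\<lambda>m. X m $ k) \<longlonglongrightarrow> 0" for k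
      by (simp add: X_def)
    \<comment> \<open>The coefficient is the \<open>e a\<close>-coordinate of \<open>v\<close>,
      since \<open>e p\<close> pairs with no other basis vector. \<open>L m\<close> is a
      transvection: \<open>X m\<close> is orthogonal to \<open>e p\<close>, which gives
      injectivity.\<close>
    define L where "L m v = v + (\<beta> v (e p) / \<beta> (e a) (e p)) *s X m" for m v
    have lin: "Vector_Spaces.linear (*s) (*s) (L m)" for m
      by unfold_locales
        (simp_all add: L_def Finite_Cartesian_Product.vec_eq_iff add_divide_distrib algebra_simps)
    have lim: "(\<lambda>m. L m v) \<longlonglongrightarrow> v" for v
    proof (rule vec_tendstoI)
      fix k
      have "(\<lambda>m. v $ k + \<beta> v (e p) / \<beta> (e a) (e p) * X m $ k) \<longlonglongrightarrow> v $ k + \<beta> v (e p) / \<beta> (e a) (e p) * 0"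
        by (intro tendsto_add tendsto_mult tendsto_const X_lim)
      then show "(\<lambda>m. L m v $ k) \<longlonglongrightarrow> v $ k" by (simp add: L_def)
    qed
    have ap: "\<beta> (e a) (e p) \<noteq> 0" using gram[OF idx(1,3)] by simp
    have L_e: "L m (e t) = moved (X m) t" if "t \<in> {1..?n}" for m t
    proof (cases "t = a")
      case False
      then have "\<beta> (e t) (e p) = 0" using zz by (intro gram0 that idx) metis
      then show ?thesis using False by (simp add: L_def moved_simps)
    qed (use ap in \<open>simp add: L_def moved_simps\<close>)
    have L_F: "L m ` F i = moved_flag (X m) i" if "i \<le> ?n" for m i
    proof -
      have "L m ` F i = vec.span (L m ` e ` {1..i})"
        using module_hom.span_image[OF lin[of m, unfolded linear_iff_module_hom], of "e ` {1..i}"]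
          normal_basisD(2)[OF nb that] by simp
      also have "L m ` e ` {1..i} = moved (X m) ` {1..i}"
        unfolding image_image using L_e that by (intro image_cong) auto
      finally show ?thesis by (simp add: moved_flag_def)
    qed
    have "\<beta> (e p) (X m) = 0" for m
    proof (rule form_zero_span)
      show "X m \<in> vec.span (e ` {a<..?n})" using X by (simp add: good_move_def)
      show "\<beta> (e p) v = 0" if "v \<in> e ` {a<..?n}" for v
        using that idx by (auto intro!: gram0)
    qed
    then have X0: "\<beta> (X m) (e p) = 0" for m using form_zero_sym by blast
    have inj: "inj (L m)" for m
    proof -
      interpret L: Vector_Spaces.linear "(*s)" "(*s)" "L m" by (rule lin)
      have "v = 0" if "L m v = 0" for v
      proof -
        have "\<beta> (L m v) (e p) = \<beta> v (e p)" by (simp add: L_def X0)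
        then have "\<beta> v (e p) = 0" using that by simp
        then show ?thesis using that by (simp add: L_def)
      qed
      then show ?thesis by (simp add: L.inj_iff_eq_0)
    qed
    define G where "G m = restrict (\<lambda>i. L m ` F i) {0..?n}" for m
    have G: "G m i = L m ` F i" if "i \<le> ?n" for m i using that by (simp add: G_def)
    have G_moved: "G m i = moved_flag (X m) i" if "i \<le> ?n" for m i using G L_F that by simp
    have G_Fl: "G m \<in> Fl" for m
      unfolding Fl_def
    proof (intro CollectI conjI allI impI)
      show "G m \<in> extensional {0..?n}" by (simp add: G_def)
      fix i
      show "vec.subspace (G m i)" if "i \<le> ?n" using G_moved[OF that] subspace_moved_flag by simp
      show "vec.dim (G m i) = i" if "i \<le> ?n"
        using vec.dim_image_eq[OF lin, of m "F i"] inj[of m] G[OF that] FlD(2)[OF F that]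
        by (simp add: inj_on_subset)
      show "G m i \<subset> G m (Suc i)" if "i < ?n"
      proof -
        have "F i \<subset> F (Suc i)" using F that by (simp only: Fl_def mem_Collect_eq)
        then have "L m ` F i \<subset> L m ` F (Suc i)"
          by (rule image_strict_mono[OF inj_on_subset[OF inj subset_UNIV]])
        then show ?thesis using G[of i m] G[of "Suc i" m] that by simp
      qed
    qed
    have rG_le: "form_rank \<beta> (G m i) (G m j) \<le> rk y i j" if "i \<le> ?n" "j \<le> ?n" for m i j
      using X[of m] that G_moved by (simp add: good_move_def)
    \<comment> \<open>Lower semicontinuity of the rank: if smaller ranks recurred, the closed
      condition with bound \<open>rk z i j - 1\<close> would pass to the limit
      \<open>F\<close>.\<close>
    have "eventually (\<lambda>m. rk z i j \<le> form_rank \<beta> (G m i) (G m j)) sequentially"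
      if ij: "i \<le> ?n" "j \<le> ?n" for i j
    proof (rule ccontr)
      assume "\<not> ?thesis"
      then have fr: "\<exists>\<^sub>F m in sequentially. form_rank \<beta> (G m i) (G m j) < rk z i j"
        by (simp add: frequently_def not_less)
      let ?Z = "{F \<in> Fl. form_rank \<beta> (F i) (F j) \<le> rk z i j - 1}"
      have "\<exists>\<^sub>F m in sequentially. G m \<in> ?Z"
        using fr by (rule frequently_elim1) (use G_Fl in auto)
      from zariski_closed_limit[OF zariski_closed_form_rank[OF ij] F lin lim this G]
      have "rk z i j \<le> rk z i j - 1" using rF[OF ij] by simp
      moreover have "0 < rk z i j" using frequently_ex[OF fr] by auto
      ultimately show False by simp
    qed
    then have "eventually (\<lambda>m. \<forall>i\<in>{..?n}. \<forall>j\<in>{..?n}. rk z i j \<le> form_rank \<beta> (G m i) (G m j)) sequentially"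
      by (intro eventually_ball_finite ballI) auto
    then have "eventually (\<lambda>m. G m \<in> Z) sequentially"
    proof (rule eventually_mono)
      fix m assume ge: "\<forall>i\<in>{..?n}. \<forall>j\<in>{..?n}. rk z i j \<le> form_rank \<beta> (G m i) (G m j)"
      obtain k where k: "k \<le> ?n" "rk z a k < form_rank \<beta> (G m a) (G m k)"
        using X[of m] G_moved idx by (auto simp: good_move_def)
      show "G m \<in> Z"
      proof (rule less.hyps[OF _ G_Fl rG_le])
        show "(\<Sum>(i, j)\<in>{..?n} \<times> {..?n}. rk y i j - form_rank \<beta> (G m i) (G m j))
          < (\<Sum>(i, j)\<in>{..?n} \<times> {..?n}. rk y i j - form_rank \<beta> (F i) (F j))"
        proof (rule sum_strict_mono_ex1)
          show "\<forall>x\<in>{..?n} \<times> {..?n}. (case x of (i, j) \<Rightarrow> rk y i j - form_rank \<beta> (G m i) (G m j))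
            \<le> (case x of (i, j) \<Rightarrow> rk y i j - form_rank \<beta> (F i) (F j))"
            using ge rF by (auto intro!: diff_le_mono2)
          have "rk y a k - form_rank \<beta> (G m a) (G m k) < rk y a k - form_rank \<beta> (F a) (F k)"
            using k rF[of a k] rG_le[of a k m] idx by auto
          then show "\<exists>x\<in>{..?n} \<times> {..?n}. (case x of (i, j) \<Rightarrow> rk y i j - form_rank \<beta> (G m i) (G m j))
            < (case x of (i, j) \<Rightarrow> rk y i j - form_rank \<beta> (F i) (F j))"
            using k idx by (intro bexI[of _ "(a, k)"]) auto
        qed simp
      qed
    qed
    then have "\<exists>\<^sub>F m in sequentially. G m \<in> Z" by (rule eventually_frequently[rotated]) simp
    from zariski_closed_limit[OF Z(1) F lin lim this G] show ?thesis .
  qed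
qed

text \<open>The last clause of \<open>D\<close> merges both diagrams: for
  \<open>\<epsilon> = -1\<close> it excludes the diagonal and turns \<open>j \<le> i\<close> into
  \<open>j < i\<close>.\<close>

lemma orbit_closure_eq:
  assumes y: "y \<in> I_O CARD('n)" and fpf: "\<epsilon> = -1 \<Longrightarrow> y \<in> I_Sp CARD('n)"
    and D: "D = {(i, j). 1 \<le> i \<and> 1 \<le> j \<and> j < y i \<and> i < y j \<and> j \<le> i \<and> (i = j \<longrightarrow> \<epsilon> \<noteq> -1)}"
  shows "orbit_closure \<beta> y = {F \<in> Fl. \<forall>(i, j) \<in> Ess D. form_rank \<beta> (F i) (F j) \<le> rk y i j}"
    (is "_ = ?R")
proof
  let ?n = "CARD('n)"
  have Ess: "i \<in> {1..?n}" "j \<in> {1..?n}" if "(i, j) \<in> Ess D" for i j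
  proof -
    have "1 \<le> i" "1 \<le> j" "j < y i" "i < y j" using that by (auto simp: Ess_def D)
    then show "i \<in> {1..?n}" "j \<in> {1..?n}" using rothe_bounds[OF y] by auto
  qed
  let ?\<Z> = "(\<lambda>(i, j). {F \<in> Fl. form_rank \<beta> (F i) (F j) \<le> rk y i j}) ` Ess D"
  have "zariski_closed {F \<in> Fl. \<forall>Z\<in>?\<Z>. F \<in> Z}"
    using Ess by (intro zariski_closed_Int) (auto intro!: zariski_closed_form_rank)
  also have "{F \<in> Fl. \<forall>Z\<in>?\<Z>. F \<in> Z} = ?R" by auto
  finally have "zariski_closed ?R" .
  moreover have "orbit \<beta> y \<subseteq> ?R" using Ess by (auto simp: orbit_def)
  ultimately show "orbit_closure \<beta> y \<subseteq> ?R"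
    unfolding orbit_closure_def by (intro hull_minimal)
  show "?R \<subseteq> orbit_closure \<beta> y"
  proof
    fix F assume R: "F \<in> ?R"
    then have F: "F \<in> Fl" by simp
    obtain e z where nb: "normal_basis e z F" by (rule normal_basis_exists[OF F])
    have z: "z \<in> I_O ?n" by (rule normal_basisD(1)[OF nb])
    have rF: "form_rank \<beta> (F i) (F j) = rk z i j" if "i \<le> ?n" "j \<le> ?n" for i j
      by (rule form_rank_normal_basis[OF nb that])
    have "rk z i j \<le> rk y i j" if "i \<le> ?n" "j \<le> ?n" for i j
    proof (rule rank_conditions_from_Ess[OF y D _ _ _ _ _ _ that])
      show "even (rk z i i) \<and> even (rk y i i)" if "\<not> \<epsilon> \<noteq> -1" "i \<le> ?n" for i
        using that normal_basis_FPF[OF nb] fpf by (auto intro!: even_rk_diagonal)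
      show "rk z i j \<le> rk y i j" if "(i, j) \<in> Ess D" for i j
        using R rF[of i j] Ess[OF that] that by auto
    qed (auto simp: rk_commute[OF z] rk_Suc_left, auto simp: rk_def)
    then have "F \<in> Z" if "zariski_closed Z" "orbit \<beta> y \<subseteq> Z" for Z
      using closure_contains[OF that y fpf F] rF by simp
    then show "F \<in> orbit_closure \<beta> y" by (simp add: orbit_closure_def hull_def)
  qed
qed

end

theorem proposition3p16:
  fixes \<beta> :: "complex ^ 'n \<Rightarrow> complex ^ 'n \<Rightarrow> complex" and y :: "nat \<Rightarrow> nat"
  assumes "bilinear_form \<beta>" and "nondegenerate \<beta>"
  shows "(symmetric_form \<beta> \<and> y \<in> I_O CARD('n) \<longrightarrow>
            orbit_closure \<beta> y =
              {F \<in> Fl. \<forall>(i, j) \<in> Ess (D_hat y). form_rank \<beta> (F i) (F j) \<le> rk y i j}) \<and>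
         (skew_form \<beta> \<and> y \<in> I_Sp CARD('n) \<longrightarrow>
            orbit_closure \<beta> y =
              {F \<in> Fl. \<forall>(i, j) \<in> Ess (D_hat_FPF y). form_rank \<beta> (F i) (F j) \<le> rk y i j})"
proof (intro conjI impI; elim conjE)
  assume sym: "symmetric_form \<beta>" and y: "y \<in> I_O CARD('n)"
  have "\<beta> v w = 1 * \<beta> w v" for v w
    using sym unfolding symmetric_form_def mult_1 by blast
  then interpret eps_form \<beta> 1
    by (intro eps_form.intro assms disjI1 refl)
  show "orbit_closure \<beta> y = {F \<in> Fl. \<forall>(i, j) \<in> Ess (D_hat y). form_rank \<beta> (F i) (F j) \<le> rk y i j}"
    using y by (intro orbit_closure_eq) (auto simp: D_hat_def)
next
  assume skew: "skew_form \<beta>" and y: "y \<in> I_Sp CARD('n)"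
  have "\<beta> v w = -1 * \<beta> w v" for v w
    using skew unfolding skew_form_def mult_minus1 by blast
  then interpret eps_form \<beta> "-1"
    by (intro eps_form.intro assms disjI2 refl)
  show "orbit_closure \<beta> y = {F \<in> Fl. \<forall>(i, j) \<in> Ess (D_hat_FPF y). form_rank \<beta> (F i) (F j) \<le> rk y i j}"
    using y by (intro orbit_closure_eq) (auto simp: D_hat_FPF_def I_Sp_def)
qed

end
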